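(* For all real $x>0$, $$ \begin{aligned} \psi(x+1)={}&\frac{\pi}{3}\log x+\frac{1}{2x}-\frac{1}{4\pi x^2}+\frac{\pi\cot(\pi x)}{e^{2\pi x}-1}+\frac{\pi\log|2\sin(\pi x)|}{2\sinh^2(\pi x)}\\ &+\sum_{k=1}^{\infty}\frac{2k}{(e^{2\pi k}-1)(k^2-x^2)}-\frac{\pi}{2}\sum_{k=1}^{\infty}\frac{\log|k^4-x^4|}{\sinh^2(\pi k)}\\ &-2\pi\sum_{k=1}^{\infty}e^{-2\pi kx}\left(k^2\sum_{n=1}^{\infty}\frac{\sin(2\pi nx)}{k^2+n^2}-k^3\sum_{n=1}^{\infty}\frac{\cos(2\pi nx)}{n(k^2+n^2)}\right), \end{aligned} $$ where, when $x=m$ is a positive integer (so that individual terms on the right-hand side are singular), the right-hand side is interpreted as its limit as $x\to m$ through non-integer values (in particular, this limit exists).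
   Context: $\psi(x)=\Gamma'(x)/\Gamma(x)$ denotes the logarithmic derivative of the gamma function (digamma function), and $\log$ is the natural logarithm. *)

theory Defs
  imports "HOL-Analysis.Analysis"
begin

text \<open>
  The library constant \<^const>\<open>Digamma\<close> is the logarithmic derivative of the gamma function.
\<close>
lemma Digamma_eq_deriv_Gamma_over_Gamma:
  fixes x :: real
  assumes "x > 0"
  shows "Digamma x = deriv Gamma x / Gamma x"
proof -
  have "x \<notin> \<int>\<^sub>\<le>\<^sub>0"
    using assms by (auto elim!: nonpos_Ints_cases)
  then have "(Gamma has_field_derivative (Gamma x * Digamma x)) (at x)"
    by (rule has_field_derivative_Gamma)
  then have "deriv Gamma x = Gamma x * Digamma x"
    by (rule DERIV_imp_deriv)
  moreover have "Gamma x > 0"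
    using assms by (rule Gamma_real_pos)
  ultimately show ?thesis by simp
qed

text \<open>
  The functions below are the general terms of the series in the identity.
  All series run over positive integers, so they are summed as \<open>\<Sum>k. f (Suc k)\<close>.
  The values at positive integers \<open>x\<close>, where some terms are singular, carry no meaning.
\<close>

definition rational_term :: "real \<Rightarrow> nat \<Rightarrow> real" where
  "rational_term x k = 2 * real k / ((exp (2 * pi * real k) - 1) * ((real k)\<^sup>2 - x\<^sup>2))"

definition log_term :: "real \<Rightarrow> nat \<Rightarrow> real" where
  "log_term x k = ln \<bar>real k ^ 4 - x ^ 4\<bar> / (sinh (pi * real k))\<^sup>2"

definition sin_term :: "real \<Rightarrow> nat \<Rightarrow> nat \<Rightarrow> real" where
  "sin_term x k n = sin (2 * pi * real n * x) / ((real k)\<^sup>2 + (real n)\<^sup>2)"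

definition cos_term :: "real \<Rightarrow> nat \<Rightarrow> nat \<Rightarrow> real" where
  "cos_term x k n = cos (2 * pi * real n * x) / (real n * ((real k)\<^sup>2 + (real n)\<^sup>2))"

definition trig_term :: "real \<Rightarrow> nat \<Rightarrow> real" where
  "trig_term x k = exp (- 2 * pi * real k * x) *
     ((real k)\<^sup>2 * (\<Sum>n. sin_term x k (Suc n)) - real k ^ 3 * (\<Sum>n. cos_term x k (Suc n)))"

definition digamma_expansion :: "real \<Rightarrow> real" where
  "digamma_expansion x =
     pi / 3 * ln x + 1 / (2 * x) - 1 / (4 * pi * x\<^sup>2)
     + pi * cot (pi * x) / (exp (2 * pi * x) - 1)
     + pi * ln \<bar>2 * sin (pi * x)\<bar> / (2 * (sinh (pi * x))\<^sup>2)
     + (\<Sum>k. rational_term x (Suc k))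
     - pi / 2 * (\<Sum>k. log_term x (Suc k))
     - 2 * pi * (\<Sum>k. trig_term x (Suc k))"

end

theory Submission
  imports Defs "HOL-Real_Asymp.Real_Asymp"
begin

text \<open>
  Let \<open>F x\<close> be the difference of the two sides. Termwise differentiation makes the transcendental
  parts collapse: with \<open>L = ln \<bar>2 sin (\<pi>x)\<bar>\<close>, the \<open>k\<close>-th term of the last series has
  derivative \<open>- 2\<pi> k\<^sup>2 exp (- 2\<pi>kx) L\<close>, which cancels against the derivative of
  \<open>\<pi> L / (2 sinh\<^sup>2 (\<pi>x))\<close> and of \<open>\<pi> cot (\<pi>x) / (exp (2\<pi>x) - 1)\<close>. What remains of \<open>F' = 0\<close> is the partial
  fraction expansion of \<open>coth (\<pi>x) / sin\<^sup>2 (\<pi>x)\<close>, obtained by multiplying the expansions of \<open>coth\<close> and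
  \<open>1 / sin\<^sup>2\<close> and decomposing each product of terms. Hence \<open>F\<close> is constant between consecutive integers;
  the singularities of the individual terms cancel at the integers, so it is one constant \<open>d\<close>.
  Along \<open>x = n + 1/2\<close> one has \<open>F x = \<kappa> ln x + o(1)\<close> for some constant \<open>\<kappa>\<close>, which forces \<open>\<kappa> = 0\<close> and \<open>d = 0\<close>.
\<close>

section \<open>Dominated series\<close>

text \<open>The shape of the last series is that of an integrating factor: for fixed
  \<open>k\<close> the inner sine sum S and cosine sum C satisfy a linear system C' = -2 pi S, S' =
  -2 pi L - 2 pi k^2 C, and exp(-2 pi k x) (k^2 S - k^3 C) is a combination from whose derivative S
  and C drop out. The delicate point is S': termwise differentiation produces a series that
  converges only conditionally, so a Clausen series is split off and treated by Abel means. The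
  elementary terms come from the pole at 0. The principal part of pi^3 coth(pi x) / sin^2(pi x)
  there is 1/x^3 + 2 pi^2/(3x); divided by 2 pi and integrated it gives -1/(4 pi x^2) + (pi/3) ln x.
  The term 1/(2x) arises in the same way from the principal part 1/x^2 of pi^2 / sin^2(pi x). The
  vanishing of the coefficient of ln x at infinity amounts to the value 1/6 - 1/(2 pi) for the sum
  of 1 / sinh^2(pi k), so the argument proves that evaluation on the way.\<close>

lemma tendsto_suminf_dominated:
  fixes f :: "nat \<Rightarrow> 'a \<Rightarrow> real"
  assumes lim: "\<And>k. (f k \<longlongrightarrow> g k) F"
    and dom: "\<forall>\<^sub>F x in F. \<forall>k. \<bar>f k x\<bar> \<le> M k"
    and M: "summable M" and F: "F \<noteq> bot"
  shows "((\<lambda>x. \<Sum>k. f k x) \<longlongrightarrow> (\<Sum>k. g k)) F"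
proof -
  have g_le: "\<bar>g k\<bar> \<le> M k" for k
  proof (rule tendsto_upperbound[OF tendsto_rabs[OF lim] _ F])
    show "\<forall>\<^sub>F x in F. \<bar>f k x\<bar> \<le> M k"
      using dom by eventually_elim simp
  qed
  have "summable g"
    by (rule summable_comparison_test'[OF M, of 0]) (use g_le in auto)
  then have lim_sum: "(\<lambda>n. \<Sum>i<n. g i) \<longlonglongrightarrow> (\<Sum>k. g k)"
    by (rule summable_LIMSEQ)
  \<comment> \<open>On \<open>S\<close> the partial sums converge uniformly, and \<open>F\<close>
    eventually lies in \<open>S\<close>; this permits exchanging the limit along \<open>F\<close>
    with the limit of the partial sums.\<close>
  define S where "S = {x. \<forall>k. \<bar>f k x\<bar> \<le> M k}"
  have unif: "uniform_limit S (\<lambda>n x. \<Sum>i<n. f i x) (\<lambda>x. \<Sum>i. f i x) sequentially"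
    by (rule Weierstrass_m_test[OF _ M]) (simp add: S_def)
  have lim': "\<forall>\<^sub>F n in sequentially. ((\<lambda>x. \<Sum>i<n. f i x) \<longlongrightarrow> (\<Sum>i<n. g i)) F"
    by (intro always_eventually allI tendsto_sum lim)
  have "\<forall>\<^sub>F x in F. x \<in> S"
    using dom by (simp add: S_def)
  from swap_uniform_limit'[OF lim' lim_sum unif this] show ?thesis
    by simp
qed

lemma DERIV_suminf_dominated:
  fixes f :: "nat \<Rightarrow> real \<Rightarrow> real"
  assumes der: "\<And>k y. a \<le> y \<Longrightarrow> y \<le> b \<Longrightarrow> (f k has_real_derivative f' k y) (at y)"
    and dom: "\<And>k y. a \<le> y \<Longrightarrow> y \<le> b \<Longrightarrow> \<bar>f' k y\<bar> \<le> M k"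
    and "summable M" "summable (\<lambda>k. f k x)" "a < x" "x < b"
  shows "((\<lambda>y. \<Sum>k. f k y) has_real_derivative (\<Sum>k. f' k x)) (at x)"
proof (rule has_field_derivative_series'(2)[where S = "{a..b}" and ?x0.0 = x])
  show "uniformly_convergent_on {a..b} (\<lambda>n x. \<Sum>i<n. f' i x)"
    by (rule Weierstrass_m_test'[OF _ \<open>summable M\<close>]) (use dom in auto)
  show "(f k has_real_derivative f' k y) (at y within {a..b})" if "y \<in> {a..b}" for k y
    using der that by (auto intro: has_field_derivative_at_within)
  show "x \<in> interior {a..b}"
    using \<open>a < x\<close> \<open>x < b\<close> by (simp add: interior_atLeastAtMost_real)
qed (use \<open>a < x\<close> \<open>x < b\<close> \<open>summable (\<lambda>k. f k x)\<close> in auto)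

text \<open>The product majorant makes the family absolutely summable over pairs, so Fubini for
  unordered sums applies. \<open>row'\<close> and \<open>col'\<close> translate the inner
  \<open>infsum\<close> back to \<open>suminf\<close>.\<close>

lemma suminf_swap_product_dominated:
  fixes f :: "nat \<Rightarrow> nat \<Rightarrow> real"
  assumes dom: "\<And>m n. \<bar>f m n\<bar> \<le> A m * B n" and A: "summable A" and B: "summable B"
    and nn: "\<And>m. 0 \<le> A m" "\<And>n. 0 \<le> B n"
  shows "(\<Sum>n. \<Sum>m. f m n) = (\<Sum>m. \<Sum>n. f m n)"
    and "summable (\<lambda>n. \<Sum>m. f m n)" and "summable (\<lambda>m. \<Sum>n. f m n)"
proof -
  have "(\<lambda>m. A m * infsum B UNIV) summable_on UNIV"
    using A nn by (intro summable_on_cmult_left) (simp add: summable_on_UNIV_nonneg_real_iff)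
  moreover have "(B has_sum infsum B UNIV) UNIV"
    using B nn by (intro has_sum_infsum) (simp add: summable_on_UNIV_nonneg_real_iff)
  ultimately have "(\<lambda>(m, n). A m * B n) summable_on UNIV \<times> UNIV"
    using nn by (intro summable_on_SigmaI[where g = "\<lambda>m. A m * infsum B UNIV"])
      (auto intro: has_sum_cmult_right)
  then have abs: "(\<lambda>p. norm (case p of (m, n) \<Rightarrow> f m n)) summable_on UNIV \<times> UNIV"
    by (rule Infinite_Sum.abs_summable_on_comparison_test') (use dom in auto)
  then have sm: "(\<lambda>(m, n). f m n) summable_on UNIV \<times> UNIV"
    by (rule abs_summable_summable)
  then have sm': "(\<lambda>(n, m). f m n) summable_on UNIV \<times> UNIV"
    by (subst summable_on_swap) (simp add: case_prod_unfold)
  have row: "summable (\<lambda>n. \<bar>f m n\<bar>)" for m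
    by (rule summable_comparison_test'[OF summable_mult[OF B, of "A m"], of 0]) (use dom in auto)
  have col: "summable (\<lambda>m. \<bar>f m n\<bar>)" for n
    by (rule summable_comparison_test'[OF summable_mult2[OF A, of "B n"], of 0]) (use dom in auto)
  have row': "(\<Sum>\<^sub>\<infinity>n. f m n) = (\<Sum>n. f m n)" for m
    using norm_summable_imp_has_sum[of "f m", OF _ summable_sums] row[of m]
    by (intro infsumI) (auto intro: summable_rabs_cancel)
  have col': "(\<Sum>\<^sub>\<infinity>m. f m n) = (\<Sum>m. f m n)" for n
    using norm_summable_imp_has_sum[of "\<lambda>m. f m n", OF _ summable_sums] col[of n]
    by (intro infsumI) (auto intro: summable_rabs_cancel)
  have hs: "((\<lambda>m. \<Sum>n. f m n) has_sum (\<Sum>\<^sub>\<infinity>m. \<Sum>\<^sub>\<infinity>n. f m n)) UNIV"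
    using has_sum_infsum[OF summable_on_Sigma_banach[OF sm]] by (simp add: row')
  have hs': "((\<lambda>n. \<Sum>m. f m n) has_sum (\<Sum>\<^sub>\<infinity>n. \<Sum>\<^sub>\<infinity>m. f m n)) UNIV"
    using has_sum_infsum[OF summable_on_Sigma_banach[OF sm']] by (simp add: col')
  have "(\<Sum>\<^sub>\<infinity>m. \<Sum>\<^sub>\<infinity>n. f m n) = (\<Sum>\<^sub>\<infinity>n. \<Sum>\<^sub>\<infinity>m. f m n)"
    by (rule infsum_swap_banach[OF sm])
  then show "(\<Sum>n. \<Sum>m. f m n) = (\<Sum>m. \<Sum>n. f m n)"
    using has_sum_imp_sums[OF hs] has_sum_imp_sums[OF hs'] by (simp add: sums_iff)
  show "summable (\<lambda>n. \<Sum>m. f m n)" "summable (\<lambda>m. \<Sum>n. f m n)"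
    using has_sum_imp_sums[OF hs'] has_sum_imp_sums[OF hs] by (simp_all add: sums_iff)
qed

section \<open>Partial fraction expansions\<close>

lemma sin_pi_mult_eq_0_iff:
  fixes z :: complex
  shows "sin (of_real pi * z) = 0 \<longleftrightarrow> z \<in> \<int>"
proof
  assume "sin (of_real pi * z) = 0"
  then obtain n :: int where "of_real pi * z = of_real (n * pi)"
    by (auto simp: sin_eq_0)
  then have "z = of_int n"
    by (simp add: mult.commute)
  then show "z \<in> \<int>"
    by simp
qed (auto simp: sin_eq_0 elim!: Ints_cases)

text \<open>Logarithmic differentiation of Euler's reflection formula Gamma(z) Gamma(1 - z) = pi /
  sin(pi z). The complex version is required because coth is later obtained at imaginary
  arguments.\<close>

lemma Digamma_reflection_complex:
  fixes z :: complex
  assumes z: "z \<notin> \<int>"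
  shows "Digamma (1 - z) - Digamma z = of_real pi * cot (of_real pi * z)"
proof -
  have z': "z \<notin> \<int>\<^sub>\<le>\<^sub>0" "1 - z \<notin> \<int>\<^sub>\<le>\<^sub>0"
    using z nonpos_Ints_subset_Ints Ints_diff[OF Ints_1, of "1 - z"] by auto
  have s: "sin (of_real pi * z) \<noteq> 0"
    using z by (simp add: sin_pi_mult_eq_0_iff)
  have "((\<lambda>z. Gamma z * Gamma (1 - z)) has_field_derivative
      Gamma z * Gamma (1 - z) * (Digamma z - Digamma (1 - z))) (at z)"
    using z' by (auto intro!: derivative_eq_intros simp: algebra_simps)
  moreover have "((\<lambda>z. of_real pi / sin (of_real pi * z)) has_field_derivative
      - ((of_real pi)\<^sup>2 * cos (of_real pi * z) / (sin (of_real pi * z))\<^sup>2)) (at z)"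
    by (rule derivative_eq_intros refl s)+ (simp add: power2_eq_square)
  ultimately have "Gamma z * Gamma (1 - z) * (Digamma z - Digamma (1 - z)) =
      - ((of_real pi)\<^sup>2 * cos (of_real pi * z) / (sin (of_real pi * z))\<^sup>2)"
    unfolding Gamma_reflection_complex by (rule DERIV_unique)
  then have "of_real pi / sin (of_real pi * z) *
      (Digamma z - Digamma (1 - z) + of_real pi * cot (of_real pi * z)) = 0"
    by (simp add: Gamma_reflection_complex cot_def distrib_left power2_eq_square)
  then have "Digamma z - Digamma (1 - z) + of_real pi * cot (of_real pi * z) = 0"
    using s by simp
  then show ?thesis
    by (simp add: algebra_simps)
qed

text \<open>Derivative of \<open>Digamma_reflection_complex\<close>, which holds on the open
  complement of the integers.\<close>

lemma Polygamma_1_reflection_complex: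
  fixes z :: complex
  assumes z: "z \<notin> \<int>"
  shows "Polygamma 1 (1 - z) + Polygamma 1 z = (of_real pi)\<^sup>2 / (sin (of_real pi * z))\<^sup>2"
proof -
  have z': "z \<notin> \<int>\<^sub>\<le>\<^sub>0" "1 - z \<notin> \<int>\<^sub>\<le>\<^sub>0"
    using z nonpos_Ints_subset_Ints Ints_diff[OF Ints_1, of "1 - z"] by auto
  have s: "sin (of_real pi * z) \<noteq> 0"
    using z by (simp add: sin_pi_mult_eq_0_iff)
  have "((\<lambda>z. Digamma (1 - z) - Digamma z) has_field_derivative
      - Polygamma 1 (1 - z) - Polygamma 1 z) (at z)"
    using z' by (auto intro!: derivative_eq_intros)
  then have "((\<lambda>z. of_real pi * cot (of_real pi * z)) has_field_derivative
      - Polygamma 1 (1 - z) - Polygamma 1 z) (at z)"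
    by (rule has_field_derivative_transform_within_open[where S = "- \<int>"])
       (use z Digamma_reflection_complex in \<open>auto simp: open_Compl\<close>)
  moreover have "((\<lambda>z. of_real pi * cot (of_real pi * z)) has_field_derivative
      - ((of_real pi)\<^sup>2 / (sin (of_real pi * z))\<^sup>2)) (at z)"
    by (rule derivative_eq_intros DERIV_cot[THEN DERIV_chain2] refl s)+
       (simp add: power2_eq_square divide_inverse)
  ultimately have "- Polygamma 1 (1 - z) - Polygamma 1 z = - ((of_real pi)\<^sup>2 / (sin (of_real pi * z))\<^sup>2)"
    by (rule DERIV_unique)
  then show ?thesis by (simp add: algebra_simps)
qed

text \<open>Subtracting the series of \<open>Digamma\<close> at \<open>1 - z\<close> and
  \<open>1 + z\<close> cancels Euler's constant and the harmonic terms. The shift from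
  \<open>1 + z\<close> to \<open>z\<close> produces 1/z, and the reflection formula supplies the
  cotangent.\<close>

lemma cot_partial_fractions_complex:
  fixes z :: complex
  assumes z: "z \<notin> \<int>"
  shows "(\<lambda>n. 2 * z / (z\<^sup>2 - (of_nat (Suc n))\<^sup>2)) sums (of_real pi * cot (of_real pi * z) - 1 / z)"
proof -
  have "z \<noteq> 0" using z by auto
  have nz: "1 + z + of_nat n \<noteq> 0" "1 - z + of_nat n \<noteq> 0" for n
  proof -
    have "z \<noteq> - of_nat (Suc n)" "z \<noteq> of_nat (Suc n)"
      using z by (metis Ints_minus Ints_of_nat) (use z in auto)
    then show "1 + z + of_nat n \<noteq> 0" "1 - z + of_nat n \<noteq> 0"
      by (auto simp: eq_neg_iff_add_eq_0 algebra_simps)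
  qed
  have "(\<lambda>n. inverse (of_nat (Suc n)) - inverse (w + of_nat n)) sums (Digamma w + euler_mascheroni)"
    if "w \<noteq> 0" for w :: complex
    using summable_sums[OF summable_Digamma[OF that]] by (simp add: Digamma_def)
  from sums_diff[OF this[of "1 - z"] this[of "1 + z"]]
  have "(\<lambda>n. inverse (1 + z + of_nat n) - inverse (1 - z + of_nat n)) sums (Digamma (1 - z) - Digamma (1 + z))"
    using nz[of 0] by (simp add: algebra_simps)
  also have "(\<lambda>n. inverse (1 + z + of_nat n) - inverse (1 - z + of_nat n)) =
      (\<lambda>n. 2 * z / (z\<^sup>2 - (of_nat (Suc n))\<^sup>2))"
  proof
    fix n
    have "z\<^sup>2 - (of_nat (Suc n))\<^sup>2 = - ((1 + z + of_nat n) * (1 - z + of_nat n))"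
      by (simp add: algebra_simps power2_eq_square)
    then show "inverse (1 + z + of_nat n) - inverse (1 - z + of_nat n) = 2 * z / (z\<^sup>2 - (of_nat (Suc n))\<^sup>2)"
      using nz[of n] by (simp only: inverse_eq_divide diff_frac_eq) (simp add: divide_simps)
  qed
  also have "Digamma (1 - z) - Digamma (1 + z) = of_real pi * cot (of_real pi * z) - 1 / z"
    using Digamma_plus1[OF \<open>z \<noteq> 0\<close>] Digamma_reflection_complex[OF z] by (simp add: algebra_simps)
  finally show ?thesis .
qed

text \<open>The cotangent expansion at z = i x, multiplied by i; both sides are then images of reals
  under \<open>of_real\<close>.\<close>

lemma coth_partial_fractions:
  fixes x :: real
  assumes "x \<noteq> 0"
  shows "(\<lambda>n. 2 * x / (x\<^sup>2 + (real (Suc n))\<^sup>2)) sums (pi * (cosh (pi * x) / sinh (pi * x)) - 1 / x)"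
proof -
  define z where "z = \<i> * of_real x"
  have "z \<notin> \<int>"
    using assms by (auto simp: z_def elim!: Ints_cases simp: complex_eq_iff)
  have i: "\<i> * (2 * (\<i> * a) / (- w)) = 2 * a / w" for a w
  proof -
    have "\<i> * (2 * (\<i> * a)) = 2 * ((\<i> * \<i>) * a)"
      by (simp only: mult_ac)
    also have "\<dots> = - (2 * a)"
      by simp
    finally show ?thesis
      by (simp only: times_divide_eq_right) simp
  qed
  from sums_mult[OF cot_partial_fractions_complex[OF \<open>z \<notin> \<int>\<close>], of \<i>]
  have "(\<lambda>n. \<i> * (2 * z / (z\<^sup>2 - (of_nat (Suc n))\<^sup>2))) sums (\<i> * (of_real pi * cot (of_real pi * z) - 1 / z))" .
  also have "(\<lambda>n. \<i> * (2 * z / (z\<^sup>2 - (of_nat (Suc n))\<^sup>2))) = (\<lambda>n. of_real (2 * x / (x\<^sup>2 + (real (Suc n))\<^sup>2)))"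
  proof
    fix n
    have "z\<^sup>2 - (of_nat (Suc n))\<^sup>2 = - of_real (x\<^sup>2 + (real (Suc n))\<^sup>2)"
      by (simp add: z_def power_mult_distrib)
    then show "\<i> * (2 * z / (z\<^sup>2 - (of_nat (Suc n))\<^sup>2)) = of_real (2 * x / (x\<^sup>2 + (real (Suc n))\<^sup>2))"
      using i [of "of_real x" "of_real (x\<^sup>2 + (real (Suc n))\<^sup>2)"] by (simp only: z_def) simp
  qed
  also have "\<i> * (of_real pi * cot (of_real pi * z) - 1 / z) =
      of_real (pi * (cosh (pi * x) / sinh (pi * x)) - 1 / x)"
  proof -
    have "cot (of_real pi * z) = of_real (cosh (pi * x)) / (\<i> * of_real (sinh (pi * x)))"
    proof -
      have "complex_of_real (cosh y) = cosh (of_real y)" "complex_of_real (sinh y) = sinh (of_real y)" for y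
        by (simp_all add: cosh_field_def sinh_field_def exp_of_real[symmetric])
      then show ?thesis
        by (simp add: cot_def z_def sinh_conv_sin cosh_conv_cos mult.left_commute)
    qed
    then show ?thesis
      using assms by (simp add: z_def field_simps)
  qed
  finally show ?thesis by (simp only: sums_of_real_iff)
qed

text \<open>In the reflection formula for \<open>Polygamma 1\<close>, the series at
  \<open>1 - z\<close> carries the poles at the positive integers. The series at \<open>z\<close>,
  without its term 1/z^2, carries those at the negative ones.\<close>

lemma csc_squared_partial_fractions:
  fixes x :: real
  assumes x: "x \<notin> \<int>"
  shows "(\<lambda>n. 1 / (x - real (Suc n))\<^sup>2 + 1 / (x + real (Suc n))\<^sup>2) sums (pi\<^sup>2 / (sin (pi * x))\<^sup>2 - 1 / x\<^sup>2)"
proof -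
  define z where "z = complex_of_real x"
  have z: "z \<notin> \<int>" using x by (simp add: z_def)
  have "z \<noteq> 0" "1 - z \<noteq> 0" using z by auto
  from Polygamma_LIMSEQ[OF this(1), of 1] 
  have "(\<lambda>k. inverse ((z + of_nat k)\<^sup>2)) sums Polygamma 1 z"
    by (simp add: numeral_2_eq_2)
  then have 1: "(\<lambda>k. inverse ((z + of_nat (Suc k))\<^sup>2)) sums (Polygamma 1 z - 1 / z\<^sup>2)"
    by (subst sums_Suc_iff) (simp add: inverse_eq_divide)
  from Polygamma_LIMSEQ[OF \<open>1 - z \<noteq> 0\<close>, of 1] 
  have 2: "(\<lambda>k. inverse ((1 - z + of_nat k)\<^sup>2)) sums Polygamma 1 (1 - z)"
    by (simp add: numeral_2_eq_2)
  from sums_add[OF 2 1] have "(\<lambda>k. inverse ((1 - z + of_nat k)\<^sup>2) + inverse ((z + of_nat (Suc k))\<^sup>2)) sums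
     ((of_real pi)\<^sup>2 / (sin (of_real pi * z))\<^sup>2 - 1 / z\<^sup>2)"
    by (simp only: Polygamma_1_reflection_complex[OF z, symmetric] add_diff_eq)
  also have "(\<lambda>k. inverse ((1 - z + of_nat k)\<^sup>2) + inverse ((z + of_nat (Suc k))\<^sup>2)) =
     (\<lambda>n. of_real (1 / (x - real (Suc n))\<^sup>2 + 1 / (x + real (Suc n))\<^sup>2))"
  proof
    fix n
    have "(1 - z + of_nat n)\<^sup>2 = (z - of_nat (Suc n))\<^sup>2"
      by (simp add: power2_eq_square algebra_simps)
    then show "inverse ((1 - z + of_nat n)\<^sup>2) + inverse ((z + of_nat (Suc n))\<^sup>2) =
      of_real (1 / (x - real (Suc n))\<^sup>2 + 1 / (x + real (Suc n))\<^sup>2)"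
      by (simp add: z_def inverse_eq_divide)
  qed
  also have "(of_real pi)\<^sup>2 / (sin (of_real pi * z))\<^sup>2 - 1 / z\<^sup>2 = of_real (pi\<^sup>2 / (sin (pi * x))\<^sup>2 - 1 / x\<^sup>2)"
    by (simp add: z_def flip: sin_of_real)
  finally show ?thesis by (simp only: sums_of_real_iff)
qed

text \<open>From |a^2 - b^2| \<le> a^2 + b^2. The bound is uniform in \<open>b\<close>, so it serves
  both as a majorant for termwise differentiation and as one factor of a product majorant.\<close>

lemma abs_diff_squares_quotient_le:
  fixes a b :: real
  assumes "a \<noteq> 0"
  shows "\<bar>2 * (a\<^sup>2 - b\<^sup>2) / (a\<^sup>2 + b\<^sup>2)\<^sup>2\<bar> \<le> 2 / a\<^sup>2" "\<bar>2 * (b\<^sup>2 - a\<^sup>2) / (b\<^sup>2 + a\<^sup>2)\<^sup>2\<bar> \<le> 2 / a\<^sup>2"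
proof -
  have pos: "a\<^sup>2 > 0" "a\<^sup>2 + b\<^sup>2 > 0" "b\<^sup>2 \<ge> 0"
    using assms by (auto intro: add_pos_nonneg)
  have "\<bar>2 * (a\<^sup>2 - b\<^sup>2) / (a\<^sup>2 + b\<^sup>2)\<^sup>2\<bar> = 2 * \<bar>a\<^sup>2 - b\<^sup>2\<bar> / (a\<^sup>2 + b\<^sup>2)\<^sup>2"
    by (simp only: abs_divide abs_mult abs_power2 abs_numeral power_abs abs_abs) (simp add: power_abs)
  also have "\<dots> \<le> 2 * (a\<^sup>2 + b\<^sup>2) / (a\<^sup>2 + b\<^sup>2)\<^sup>2"
    using pos by (intro divide_right_mono mult_left_mono) (auto simp: abs_le_iff)
  also have "\<dots> = 2 / (a\<^sup>2 + b\<^sup>2)"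
  proof -
    have "2 * w / w\<^sup>2 = 2 / w" if "w > 0" for w :: real
      using that by (simp add: power2_eq_square)
    then show ?thesis using pos by blast
  qed
  also have "\<dots> \<le> 2 / a\<^sup>2"
    using pos by (intro divide_left_mono mult_pos_pos) auto
  finally show 1: "\<bar>2 * (a\<^sup>2 - b\<^sup>2) / (a\<^sup>2 + b\<^sup>2)\<^sup>2\<bar> \<le> 2 / a\<^sup>2" .
  have "2 * (b\<^sup>2 - a\<^sup>2) / (b\<^sup>2 + a\<^sup>2)\<^sup>2 = - (2 * (a\<^sup>2 - b\<^sup>2) / (a\<^sup>2 + b\<^sup>2)\<^sup>2)"
    by (simp add: add.commute minus_divide_left)
  then show "\<bar>2 * (b\<^sup>2 - a\<^sup>2) / (b\<^sup>2 + a\<^sup>2)\<^sup>2\<bar> \<le> 2 / a\<^sup>2"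
    using 1 by simp
qed

lemma summable_inverse_squares: "summable (\<lambda>n. c / (real (Suc n))\<^sup>2)"
proof -
  have "(\<lambda>n. c * (1 / (real (Suc n))\<^sup>2)) sums (c * (pi\<^sup>2 / 6))"
    using inverse_squares_sums by (intro sums_mult) (simp add: add.commute)
  then show ?thesis by (simp add: sums_iff)
qed

text \<open>Termwise derivative of \<open>coth_partial_fractions\<close>.\<close>

lemma csch_squared_partial_fractions:
  fixes x :: real
  assumes x: "x > 0"
  shows "(\<lambda>m. 2 * ((real (Suc m))\<^sup>2 - x\<^sup>2) / ((real (Suc m))\<^sup>2 + x\<^sup>2)\<^sup>2) sums
    (1 / x\<^sup>2 - pi\<^sup>2 / (sinh (pi * x))\<^sup>2)"
proof -
  define f where "f = (\<lambda>m y. 2 * y / (y\<^sup>2 + (real (Suc m))\<^sup>2))"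
  define f' where "f' = (\<lambda>m y. 2 * ((real (Suc m))\<^sup>2 - y\<^sup>2) / ((real (Suc m))\<^sup>2 + y\<^sup>2)\<^sup>2)"
  have f_sums: "(\<lambda>m. f m y) sums (pi * (cosh (pi * y) / sinh (pi * y)) - 1 / y)" if "y \<noteq> 0" for y
    unfolding f_def using that by (rule coth_partial_fractions)
  have bound: "\<bar>f' m y\<bar> \<le> 2 / (real (Suc m))\<^sup>2" for m y
    unfolding f'_def by (intro abs_diff_squares_quotient_le) simp
  have der: "(f m has_real_derivative f' m y) (at y)" for m y
  proof -
    have nz: "y\<^sup>2 + (real (Suc m))\<^sup>2 \<noteq> 0"
      by (metis add_nonneg_pos of_nat_0_less_iff zero_le_power2 zero_less_Suc zero_less_power less_irrefl)
    have "(f m has_real_derivative (2 * (y\<^sup>2 + (real (Suc m))\<^sup>2) - 2 * y * (2 * y)) /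
        ((y\<^sup>2 + (real (Suc m))\<^sup>2) * (y\<^sup>2 + (real (Suc m))\<^sup>2))) (at y)"
      unfolding f_def using nz
      by (auto intro!: derivative_eq_intros simp del: of_nat_Suc)
    also have "(2 * (y\<^sup>2 + (real (Suc m))\<^sup>2) - 2 * y * (2 * y)) /
        ((y\<^sup>2 + (real (Suc m))\<^sup>2) * (y\<^sup>2 + (real (Suc m))\<^sup>2)) = f' m y"
      unfolding f'_def by (simp add: power2_eq_square algebra_simps del: of_nat_Suc)
    finally show ?thesis .
  qed
  have "((\<lambda>y. \<Sum>m. f m y) has_real_derivative (\<Sum>m. f' m x)) (at x)"
    by (rule DERIV_suminf_dominated[where a = "x / 2" and b = "2 * x", OF der bound summable_inverse_squares])
       (use x f_sums in \<open>auto simp: sums_iff\<close>)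
  then have "((\<lambda>y. pi * (cosh (pi * y) / sinh (pi * y)) - 1 / y) has_real_derivative (\<Sum>m. f' m x)) (at x)"
    by (rule has_field_derivative_transform_within_open[where S = "{0<..}"])
       (use x f_sums in \<open>auto simp: sums_iff\<close>)
  moreover have "((\<lambda>y. pi * (cosh (pi * y) / sinh (pi * y)) - 1 / y) has_real_derivative
      pi * ((sinh (pi * x) * pi * sinh (pi * x) - cosh (pi * x) * (cosh (pi * x) * pi)) /
        (sinh (pi * x) * sinh (pi * x))) + 1 / x\<^sup>2) (at x)"
    using x by (auto intro!: derivative_eq_intros simp: power2_eq_square right_diff_distrib mult_ac)
  moreover have "pi * ((sinh (pi * x) * pi * sinh (pi * x) - cosh (pi * x) * (cosh (pi * x) * pi)) /
        (sinh (pi * x) * sinh (pi * x))) + 1 / x\<^sup>2 = 1 / x\<^sup>2 - pi\<^sup>2 / (sinh (pi * x))\<^sup>2"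
  proof -
    have "sinh (pi * x) * pi * sinh (pi * x) - cosh (pi * x) * (cosh (pi * x) * pi) = - pi"
      using hyperbolic_pythagoras[of "pi * x"] by (simp add: power2_eq_square) algebra
    then show ?thesis
      by (simp only:) (simp add: power2_eq_square)
  qed
  ultimately have "(\<Sum>m. f' m x) = 1 / x\<^sup>2 - pi\<^sup>2 / (sinh (pi * x))\<^sup>2"
    by (metis DERIV_unique)
  moreover have "summable (\<lambda>m. f' m x)"
    by (rule summable_comparison_test'[OF summable_inverse_squares, of 0]) (use bound in auto)
  ultimately show ?thesis
    by (simp add: sums_iff f'_def)
qed

text \<open>Partial fractions in \<open>x\<close>. At the double poles \<plusminus>b the odd factor
  2x/(x^2 + a^2) contributes its values \<plusminus>2b/(a^2 + b^2) to the double part and its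
  derivative 2(a^2 - b^2)/(a^2 + b^2)^2, equal at both points, to the simple part. At \<plusminus>ia
  the other factor takes the value -2(a^2 - b^2)/(a^2 + b^2)^2.\<close>

lemma partial_fraction_product:
  fixes x a b :: real
  assumes "x\<^sup>2 + a\<^sup>2 \<noteq> 0" "a\<^sup>2 + b\<^sup>2 \<noteq> 0" "x \<noteq> b" "x \<noteq> - b"
  shows "2 * x / (x\<^sup>2 + a\<^sup>2) * (1 / (x - b)\<^sup>2 + 1 / (x + b)\<^sup>2) =
    2 * b / (b\<^sup>2 + a\<^sup>2) * (1 / (x - b)\<^sup>2 - 1 / (x + b)\<^sup>2)
    + 2 * (a\<^sup>2 - b\<^sup>2) / (a\<^sup>2 + b\<^sup>2)\<^sup>2 * (2 * x / (x\<^sup>2 - b\<^sup>2))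
    - 2 * (a\<^sup>2 - b\<^sup>2) / (a\<^sup>2 + b\<^sup>2)\<^sup>2 * (2 * x / (x\<^sup>2 + a\<^sup>2))"
proof -
  define D A B where "D = x\<^sup>2 - b\<^sup>2" and "A = x\<^sup>2 + a\<^sup>2" and "B = a\<^sup>2 + b\<^sup>2"
  have nz: "x - b \<noteq> 0" "x + b \<noteq> 0" "A \<noteq> 0" "B \<noteq> 0" and D: "D = (x - b) * (x + b)"
    using assms by (auto simp: A_def B_def D_def power2_eq_square algebra_simps eq_neg_iff_add_eq_0)
  then have "D \<noteq> 0" by simp
  note D = D this
  have u: "1 / (x - b)\<^sup>2 + 1 / (x + b)\<^sup>2 = 2 * (x\<^sup>2 + b\<^sup>2) / D\<^sup>2"
    using nz by (simp add: D divide_simps) (simp add: power2_eq_square algebra_simps)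
  have v: "1 / (x - b)\<^sup>2 - 1 / (x + b)\<^sup>2 = 4 * x * b / D\<^sup>2"
    using nz by (simp add: D divide_simps) (simp add: power2_eq_square algebra_simps)
  \<comment> \<open>The numerator is written as a combination of \<open>A\<close> and
    \<open>D\<close>, so that each part cancels one factor of the denominator: the \<open>A\<close>
    part leaves the double poles, the \<open>D\<close> part the simple ones.\<close>
  have key: "(x\<^sup>2 + b\<^sup>2) * B = 2 * b\<^sup>2 * A + (a\<^sup>2 - b\<^sup>2) * D"
    by (simp add: A_def B_def D_def power2_eq_square algebra_simps)
  have AB: "A = D + B"
    by (simp add: A_def B_def D_def)
  have "2 * x / A * (2 * (x\<^sup>2 + b\<^sup>2) / D\<^sup>2) = 4 * x * ((x\<^sup>2 + b\<^sup>2) * B) / (A * B * D\<^sup>2)"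
    using nz D(2) by (simp add: field_simps)
  also have "\<dots> = 2 * b / B * (4 * x * b / D\<^sup>2) + 4 * x * (a\<^sup>2 - b\<^sup>2) / (A * B * D)"
    unfolding key using nz D(2) by (simp add: field_simps power2_eq_square)
  also have "4 * x * (a\<^sup>2 - b\<^sup>2) / (A * B * D) = 2 * (a\<^sup>2 - b\<^sup>2) / B\<^sup>2 * (2 * x / D) - 2 * (a\<^sup>2 - b\<^sup>2) / B\<^sup>2 * (2 * x / A)"
  proof -
    have "2 * x / D - 2 * x / A = 2 * x * B / (A * D)"
      using nz D(2) by (simp add: AB field_simps)
    then have "2 * (a\<^sup>2 - b\<^sup>2) / B\<^sup>2 * (2 * x / D - 2 * x / A) = 2 * (a\<^sup>2 - b\<^sup>2) / B\<^sup>2 * (2 * x * B / (A * D))"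
      by simp
    also have "\<dots> = 4 * x * (a\<^sup>2 - b\<^sup>2) / (A * B * D)"
      using nz D(2) by (simp add: field_simps power2_eq_square)
    finally show ?thesis by (simp add: right_diff_distrib)
  qed
  finally show ?thesis
    unfolding u v by (simp add: A_def B_def D_def add.commute)
qed

lemma real_not_Int_imp:
  fixes x :: real
  assumes "x \<notin> \<int>"
  shows "x \<noteq> real n" "x \<noteq> - real n" "x\<^sup>2 \<noteq> (real n)\<^sup>2" "(real n)\<^sup>2 - x\<^sup>2 \<noteq> 0" "real n ^ 4 - x ^ 4 \<noteq> 0"
proof -
  show 1: "x \<noteq> real n" "x \<noteq> - real n"
    using assms by auto
  then show 2: "x\<^sup>2 \<noteq> (real n)\<^sup>2"
    by (simp add: power2_eq_iff)
  then show 3: "(real n)\<^sup>2 - x\<^sup>2 \<noteq> 0"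
    by simp
  have "x \<noteq> 0" using assms by auto
  then have "(real n)\<^sup>2 + x\<^sup>2 > 0" by (intro add_nonneg_pos) simp_all
  moreover have "real n ^ 4 - x ^ 4 = ((real n)\<^sup>2 - x\<^sup>2) * ((real n)\<^sup>2 + x\<^sup>2)"
    by (simp add: algebra_simps power2_eq_square power4_eq_xxxx)
  ultimately show "real n ^ 4 - x ^ 4 \<noteq> 0"
    using 3 by (metis mult_eq_0_iff less_irrefl)
qed

text \<open>A Mittag-Leffler expansion with the principal part at 0 moved to the right. The double
  poles at \<plusminus>k carry coth(pi k). The function x^3/(k^4 - x^4) has residue -1/4 at all four
  points \<plusminus>k and \<plusminus>ik, and the residue needed is the same at each:
  -pi^2/sinh^2(pi k) is the derivative of pi coth(pi x) at \<plusminus>k and the value of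
  pi^2/sin^2(pi x) at \<plusminus>ik.\<close>

lemma coth_csc_squared_partial_fractions:
  fixes x :: real
  assumes x: "x > 0" "x \<notin> \<int>"
  shows "(\<lambda>k. pi * (cosh (pi * real (Suc k)) / sinh (pi * real (Suc k))) *
        (1 / (x - real (Suc k))\<^sup>2 - 1 / (x + real (Suc k))\<^sup>2)
      + 4 * pi\<^sup>2 * (x ^ 3 / ((real (Suc k) ^ 4 - x ^ 4) * (sinh (pi * real (Suc k)))\<^sup>2))) sums
    (pi * (cosh (pi * x) / sinh (pi * x)) * (pi\<^sup>2 / (sin (pi * x))\<^sup>2) - 1 / x ^ 3 - 2 * pi\<^sup>2 / (3 * x))"
proof -
  define N where "N k = real (Suc k)" for k
  have N: "N k > 0" for k by (simp add: N_def)
  define c where "c m = 2 * x / (x\<^sup>2 + (N m)\<^sup>2)" for m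
  define u where "u n = 1 / (x - N n)\<^sup>2" for n
  define v where "v n = 1 / (x + N n)\<^sup>2" for n
  define K where "K m n = 2 * ((N m)\<^sup>2 - (N n)\<^sup>2) / ((N m)\<^sup>2 + (N n)\<^sup>2)\<^sup>2" for m n
  define CS where "CS k = pi * (cosh (pi * N k) / sinh (pi * N k))" for k
  define SH where "SH k = pi\<^sup>2 / (sinh (pi * N k))\<^sup>2" for k
  define C where "C = pi * (cosh (pi * x) / sinh (pi * x)) - 1 / x"
  define W where "W = pi\<^sup>2 / (sin (pi * x))\<^sup>2 - 1 / x\<^sup>2"
  have c: "c sums C"
    using coth_partial_fractions[of x] x by (simp add: c_def[abs_def] C_def N_def)
  have w: "(\<lambda>n. u n + v n) sums W"
    using csc_squared_partial_fractions[of x] x by (simp add: u_def v_def W_def N_def)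
  have coth: "(\<lambda>m. 2 * N n / ((N n)\<^sup>2 + (N m)\<^sup>2)) sums (CS n - 1 / N n)" for n
    using coth_partial_fractions[of "N n"] N[of n] by (simp add: CS_def N_def)
  have csch: "(\<lambda>m. K m n) sums (1 / (N n)\<^sup>2 - SH n)" for n
    using csch_squared_partial_fractions[of "N n"] N[of n] by (simp add: SH_def K_def N_def)
  have nz: "x \<noteq> N n" "x \<noteq> - N n" "x\<^sup>2 + (N n)\<^sup>2 > 0" "(N m)\<^sup>2 + (N n)\<^sup>2 > 0" for m n
    using real_not_Int_imp[OF x(2)] N[of n] by (auto simp: N_def intro!: add_nonneg_pos simp del: of_nat_Suc)
  \<comment> \<open>In this decomposition only the sum of \<open>K m n * c m\<close> needs an exchange of summation;
    the antisymmetry of \<open>K\<close> makes its value cancel in the end.\<close>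
  have pf: "c m * (u n + v n) = 2 * N n / ((N n)\<^sup>2 + (N m)\<^sup>2) * (u n - v n)
      + K m n * (2 * x / (x\<^sup>2 - (N n)\<^sup>2)) - K m n * c m" for m n
    unfolding c_def u_def v_def K_def
    by (rule partial_fraction_product) (use nz(1,2)[of n] nz(3)[of m] nz(4)[of m n] in auto)
  have Kc_bound: "\<bar>K m n * c m\<bar> \<le> 2 * x / (N m)\<^sup>2 * (2 / (N n)\<^sup>2)" for m n
  proof -
    have "\<bar>K m n\<bar> \<le> 2 / (N n)\<^sup>2"
      unfolding K_def using N[of n] by (intro abs_diff_squares_quotient_le) auto
    moreover have "\<bar>c m\<bar> \<le> 2 * x / (N m)\<^sup>2"
      unfolding c_def using x N[of m] nz[of m] by (auto intro!: divide_left_mono mult_pos_pos)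
    ultimately have "\<bar>K m n\<bar> * \<bar>c m\<bar> \<le> 2 / (N n)\<^sup>2 * (2 * x / (N m)\<^sup>2)"
      by (intro mult_mono) auto
    then show ?thesis by (simp add: abs_mult mult.commute)
  qed
  have sN: "summable (\<lambda>m. a / (N m)\<^sup>2)" for a
    unfolding N_def by (rule summable_inverse_squares)
  have swap: "(\<Sum>n. \<Sum>m. K m n * c m) = (\<Sum>m. \<Sum>n. K m n * c m)"
    and sw: "summable (\<lambda>n. \<Sum>m. K m n * c m)"
    and sw': "summable (\<lambda>m. \<Sum>n. K m n * c m)"
    by (rule suminf_swap_product_dominated[OF Kc_bound sN sN]; use x in simp)+
  have sKc: "summable (\<lambda>m. K m n * c m)" for n
  proof (rule summable_comparison_test'[where N = 0])
    show "summable (\<lambda>m. 2 * x / (N m)\<^sup>2 * (2 / (N n)\<^sup>2))"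
      by (rule summable_mult2[OF sN])
  qed (use Kc_bound in \<open>simp only: real_norm_def\<close>)
  have "(\<Sum>n. K m n * c m) = - (c m * (1 / (N m)\<^sup>2 - SH m))" for m
  proof -
    \<comment> \<open>Antisymmetry of \<open>K\<close> turns the sum over its second index into the
      negative of the \<open>csch\<close> expansion at the integer \<open>N m\<close>.\<close>
    have "(\<lambda>n. K m n * c m) = (\<lambda>n. - (c m * K n m))"
      by (simp add: K_def fun_eq_iff add.commute) (simp add: algebra_simps divide_simps)
    then show ?thesis
      using sums_minus[OF sums_mult[OF csch[of m], of "c m"]] by (simp add: sums_iff)
  qed
  note inner = this
  have "summable (\<lambda>m. c m * (1 / (N m)\<^sup>2 - SH m))"
    using sw' unfolding inner by (simp add: summable_minus_iff)
  \<comment> \<open>The exchanged double sum reappears here with the opposite sign. Adding this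
    series to \<open>row\<close> eliminates its unknown value.\<close>
  then have third: "(\<lambda>m. c m * (1 / (N m)\<^sup>2 - SH m)) sums - (\<Sum>n. \<Sum>m. K m n * c m)"
    unfolding swap inner by (simp add: suminf_minus summable_sums)
  \<comment> \<open>\<open>pf\<close> summed over \<open>m\<close> for fixed \<open>n\<close>: the
    expansions of coth and csch^2 at the integer \<open>N n\<close> evaluate the first two parts,
    and the \<open>K\<close> part stays as an unknown.\<close>
  have row: "C * (u n + v n) = (CS n - 1 / N n) * (u n - v n)
      + (1 / (N n)\<^sup>2 - SH n) * (2 * x / (x\<^sup>2 - (N n)\<^sup>2)) - (\<Sum>m. K m n * c m)" for n
  proof -
    have "(\<lambda>m. c m * (u n + v n)) sums (C * (u n + v n))"
      by (rule sums_mult2[OF c])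
    moreover have "(\<lambda>m. c m * (u n + v n)) sums ((CS n - 1 / N n) * (u n - v n)
      + (1 / (N n)\<^sup>2 - SH n) * (2 * x / (x\<^sup>2 - (N n)\<^sup>2)) - (\<Sum>m. K m n * c m))"
      unfolding pf by (intro sums_diff sums_add sums_mult2 coth csch summable_sums sKc)
    ultimately show ?thesis by (rule sums_unique2)
  qed
  \<comment> \<open>The first three summands build (C + 1/x)(W + 1/x^2) - 1/x^3, the product of the
    full functions. The next two add the unknown double sum and its negative. The last one brings in
    zeta(2) and removes what is left of the rational terms.\<close>
  have "(\<lambda>n. (u n + v n) * (1 / x) + c n * (1 / x\<^sup>2) + C * (u n + v n) + (\<Sum>m. K m n * c m)
      + c n * (1 / (N n)\<^sup>2 - SH n) - 4 / x / (N n)\<^sup>2) sums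
    (W * (1 / x) + C * (1 / x\<^sup>2) + C * W + (\<Sum>n. \<Sum>m. K m n * c m) + - (\<Sum>n. \<Sum>m. K m n * c m)
      - 4 / x * (pi\<^sup>2 / 6))"
  proof (intro sums_add sums_diff sums_mult sums_mult2 c w third summable_sums sw)
    show "(\<lambda>n. 4 / x / (N n)\<^sup>2) sums (4 / x * (pi\<^sup>2 / 6))"
      using sums_mult[OF inverse_squares_sums, of "4 / x"] by (simp add: N_def add.commute)
  qed
  also have "(\<lambda>n. (u n + v n) * (1 / x) + c n * (1 / x\<^sup>2) + C * (u n + v n) + (\<Sum>m. K m n * c m)
      + c n * (1 / (N n)\<^sup>2 - SH n) - 4 / x / (N n)\<^sup>2) =
    (\<lambda>n. CS n * (u n - v n) + 4 * (x ^ 3 / (N n ^ 4 - x ^ 4)) * SH n)"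
  proof
    fix n
    define D A where "D = x\<^sup>2 - (N n)\<^sup>2" and "A = x\<^sup>2 + (N n)\<^sup>2"
    have nz': "x - N n \<noteq> 0" "x + N n \<noteq> 0" "A \<noteq> 0" and D: "D = (x - N n) * (x + N n)"
      using nz[of n] by (auto simp: A_def D_def power2_eq_square algebra_simps eq_neg_iff_add_eq_0)
    then have "D \<noteq> 0" by simp
    have u': "u n + v n = 2 * A / D\<^sup>2"
      using nz' by (simp add: u_def v_def A_def D divide_simps) (simp add: power2_eq_square algebra_simps)
    have v': "u n - v n = 4 * x * N n / D\<^sup>2"
      using nz' by (simp add: u_def v_def D divide_simps) (simp add: power2_eq_square algebra_simps)
    \<comment> \<open>The simple poles at \<plusminus>n and those at \<plusminus>in enter with the
      same coefficient, so they merge into one fraction with denominator D A = x^4 - n^4.\<close>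
    have four: "2 * x / D + c n = 4 * x ^ 3 / (D * A)"
      using nz' \<open>D \<noteq> 0\<close> unfolding c_def A_def[symmetric]
      by (simp add: divide_simps) (simp add: A_def D_def algebra_simps power2_eq_square power3_eq_cube)
    have four': "N n ^ 4 - x ^ 4 = - (D * A)"
      by (simp add: A_def D_def algebra_simps power2_eq_square power4_eq_xxxx)
    \<comment> \<open>Here \<open>S\<close> is the unknown inner sum, which occurs with both signs.
      The first premise says that the terms free of coth, sinh and \<open>C\<close> add up to zero;
      the two facts that follow prove it.\<close>
    have regroup: "a * i + b * j + ((p - k) * d + (e - s) * g - S) + S + b * (e - s) - z = p * d + t"
      if "a * i + b * j - d * k + e * (g + b) - z = 0" "t = - (s * (g + b))"
      for a b d e g i j k p s S t z :: real
      using that by (simp add: algebra_simps)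
    have "(u n + v n) * (1 / x) - (u n - v n) * (1 / N n) = - 2 / (x * D)"
    proof -
      have "(u n + v n) * (1 / x) - (u n - v n) * (1 / N n) = (2 * A - 4 * x\<^sup>2) / (x * D\<^sup>2)"
        unfolding u' v' using x N[of n] \<open>D \<noteq> 0\<close> by (simp add: field_simps power2_eq_square)
      also have "2 * A - 4 * x\<^sup>2 = - 2 * D"
        by (simp add: A_def D_def)
      finally show ?thesis
        using \<open>D \<noteq> 0\<close> by (simp add: power2_eq_square)
    qed
    moreover have "- 2 / (x * D) + c n * (1 / x\<^sup>2) + (1 / (N n)\<^sup>2) * (4 * x ^ 3 / (D * A)) = 4 / x / (N n)\<^sup>2"
    proof -
      have "- 2 / (x * D) + c n * (1 / x\<^sup>2) + (1 / (N n)\<^sup>2) * (4 * x ^ 3 / (D * A)) =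
          ((2 * (D - A)) * (N n)\<^sup>2 + 4 * x ^ 4) / (x * (N n)\<^sup>2 * (D * A))"
        unfolding c_def A_def[symmetric] using x N[of n] nz' \<open>D \<noteq> 0\<close>
        by (simp add: field_simps power2_eq_square power3_eq_cube power4_eq_xxxx)
      also have "(2 * (D - A)) * (N n)\<^sup>2 + 4 * x ^ 4 = 4 * (D * A)"
        by (simp add: A_def D_def algebra_simps power2_eq_square power4_eq_xxxx)
      finally show ?thesis
        using \<open>D \<noteq> 0\<close> nz' by simp
    qed
    ultimately have "(u n + v n) * (1 / x) + c n * (1 / x\<^sup>2) - (u n - v n) * (1 / N n)
      + 1 / (N n)\<^sup>2 * (2 * x / D + c n) - 4 / x / (N n)\<^sup>2 = 0"
      unfolding four by linarith
    moreover have "4 * (x ^ 3 / (N n ^ 4 - x ^ 4)) * SH n = - (SH n * (2 * x / D + c n))"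
      unfolding four four' by simp
    ultimately show "(u n + v n) * (1 / x) + c n * (1 / x\<^sup>2) + C * (u n + v n) + (\<Sum>m. K m n * c m)
      + c n * (1 / (N n)\<^sup>2 - SH n) - 4 / x / (N n)\<^sup>2 =
      CS n * (u n - v n) + 4 * (x ^ 3 / (N n ^ 4 - x ^ 4)) * SH n"
      unfolding row D_def[symmetric] by (rule regroup)
  qed
  also have "W * (1 / x) + C * (1 / x\<^sup>2) + C * W + (\<Sum>n. \<Sum>m. K m n * c m) + - (\<Sum>n. \<Sum>m. K m n * c m)
      - 4 / x * (pi\<^sup>2 / 6) =
    pi * (cosh (pi * x) / sinh (pi * x)) * (pi\<^sup>2 / (sin (pi * x))\<^sup>2) - 1 / x ^ 3 - 2 * pi\<^sup>2 / (3 * x)"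
  proof -
    have "W * (1 / x) + C * (1 / x\<^sup>2) + C * W = (C + 1 / x) * (W + 1 / x\<^sup>2) - 1 / x ^ 3"
      using x by (simp add: field_simps power2_eq_square power3_eq_cube)
    then show ?thesis
      by (simp add: C_def W_def)
  qed
  finally show ?thesis
    by (simp add: CS_def SH_def N_def u_def v_def mult_ac)
qed

text \<open>It links the weights 1/(exp(2 pi k) - 1) of the expansion to the values coth(pi k) in
  the partial fractions.\<close>

lemma inverse_exp_minus_1_eq_coth:
  fixes y :: real
  assumes "y > 0"
  shows "1 / (exp (2 * pi * y) - 1) = (cosh (pi * y) / sinh (pi * y) - 1) / 2"
proof -
  define e where "e = exp (pi * y)"
  have e: "e > 1" using assms by (simp add: e_def)
  then have "e * e > 1" by (metis less_1_mult)
  have "exp (2 * pi * y) = e * e"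
    by (simp add: e_def flip: exp_add)
  moreover have "cosh (pi * y) / sinh (pi * y) = (e * e + 1) / (e * e - 1)"
    using e \<open>e * e > 1\<close> by (simp add: cosh_field_def sinh_field_def exp_minus e_def[symmetric] field_simps)
  ultimately show ?thesis
    using \<open>e * e > 1\<close> by (simp add: field_simps)
qed

text \<open>With 1/(exp(2 pi k) - 1) = (coth(pi k) - 1)/2, the coth part is the previous expansion
  divided by 2 pi. The part -1/2 requires the sum of \<open>u n - v n\<close>, that is
  \<open>u n + v n\<close> minus twice \<open>v n\<close>: the former sums to the csc^2 expansion,
  while \<open>v\<close> sums to \<open>Polygamma 1 (x + 1)\<close>. This is how the trigamma
  function enters.\<close>

lemma Polygamma_1_plus1_sums:
  fixes x :: real
  assumes x: "x > 0" "x \<notin> \<int>"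
  shows "(\<lambda>k. 4 * real (Suc k) * x / ((exp (2 * pi * real (Suc k)) - 1) * ((real (Suc k))\<^sup>2 - x\<^sup>2)\<^sup>2)
      + 2 * pi * (x ^ 3 / ((real (Suc k) ^ 4 - x ^ 4) * (sinh (pi * real (Suc k)))\<^sup>2))) sums
    (Polygamma 1 (x + 1) + pi\<^sup>2 / ((sin (pi * x))\<^sup>2 * (exp (2 * pi * x) - 1))
      - 1 / (2 * pi * x ^ 3) - pi / (3 * x) + 1 / (2 * x\<^sup>2))"
proof -
  define N where "N k = real (Suc k)" for k
  have N: "N k > 0" for k by (simp add: N_def)
  define u where "u n = 1 / (x - N n)\<^sup>2" for n
  define v where "v n = 1 / (x + N n)\<^sup>2" for n
  define ct where "ct y = cosh (pi * y) / sinh (pi * y)" for y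
  have ct: "1 / (exp (2 * pi * y) - 1) = (ct y - 1) / 2" if "y > 0" for y
    unfolding ct_def using that by (rule inverse_exp_minus_1_eq_coth)
  have regroup2: "1 / (2 * pi) * (pi * c * q - 1 / x ^ 3 - 2 * pi\<^sup>2 / (3 * x)) - 1 / 2 * (q - 1 / x\<^sup>2 - 2 * p) =
      p + q * ((c - 1) / 2) - 1 / (2 * pi * x ^ 3) - pi / (3 * x) + 1 / (2 * x\<^sup>2)" for c q p
    using x by (simp add: field_simps power2_eq_square)
  have nz: "x \<noteq> N n" "x \<noteq> - N n" for n
    using real_not_Int_imp[OF x(2)] by (auto simp: N_def simp del: of_nat_Suc)
  have v: "v sums Polygamma 1 (x + 1)"
    using Polygamma_LIMSEQ[of "x + 1" 1] x
    by (simp add: v_def[abs_def] N_def power2_eq_square inverse_eq_divide add_ac)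
  have "(\<lambda>n. u n + v n) sums (pi\<^sup>2 / (sin (pi * x))\<^sup>2 - 1 / x\<^sup>2)"
    using csc_squared_partial_fractions[of x] x by (simp add: u_def v_def N_def)
  from sums_diff[OF this sums_mult[OF v, of 2]]
  have "(\<lambda>n. u n + v n - 2 * v n) sums (pi\<^sup>2 / (sin (pi * x))\<^sup>2 - 1 / x\<^sup>2 - 2 * Polygamma 1 (x + 1))" .
  note sums_diff[OF sums_mult[OF coth_csc_squared_partial_fractions[OF x], of "1 / (2 * pi)"]
      sums_mult[OF this, of "1 / 2"]]
  note sums = this[folded N_def, folded ct_def u_def v_def]
  have regroup: "1 / (2 * pi) * (pi * a * (b - c) + 4 * pi\<^sup>2 * t) - 1 / 2 * (b + c - 2 * c) =
      (a - 1) / 2 * (b - c) + 2 * pi * t" for a b c t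
    by (simp add: field_simps power2_eq_square)
  have "(\<lambda>k. 1 / (2 * pi) * (pi * ct (N k) * (u k - v k) + 4 * pi\<^sup>2 * (x ^ 3 / ((N k ^ 4 - x ^ 4) * (sinh (pi * N k))\<^sup>2)))
        - 1 / 2 * (u k + v k - 2 * v k)) =
      (\<lambda>k. 4 * N k * x / ((exp (2 * pi * N k) - 1) * ((N k)\<^sup>2 - x\<^sup>2)\<^sup>2)
        + 2 * pi * (x ^ 3 / ((N k ^ 4 - x ^ 4) * (sinh (pi * N k))\<^sup>2)))"
  proof
    fix k
    have nz': "x - N k \<noteq> 0" "x + N k \<noteq> 0"
      using nz[of k] by auto
    have sq: "((N k)\<^sup>2 - x\<^sup>2)\<^sup>2 = ((x - N k) * (x + N k))\<^sup>2"
      by (simp add: power2_eq_square algebra_simps)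
    have "u k - v k = 4 * N k * x / ((N k)\<^sup>2 - x\<^sup>2)\<^sup>2"
      unfolding sq using nz' by (simp add: u_def v_def divide_simps) (simp add: power2_eq_square algebra_simps)
    then have "4 * N k * x / ((exp (2 * pi * N k) - 1) * ((N k)\<^sup>2 - x\<^sup>2)\<^sup>2) = 1 / (exp (2 * pi * N k) - 1) * (u k - v k)"
      by simp
    also have "\<dots> = (ct (N k) - 1) / 2 * (u k - v k)"
      by (simp only: ct[OF N])
    finally show "1 / (2 * pi) * (pi * ct (N k) * (u k - v k) + 4 * pi\<^sup>2 * (x ^ 3 / ((N k ^ 4 - x ^ 4) * (sinh (pi * N k))\<^sup>2)))
        - 1 / 2 * (u k + v k - 2 * v k) =
      4 * N k * x / ((exp (2 * pi * N k) - 1) * ((N k)\<^sup>2 - x\<^sup>2)\<^sup>2)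
        + 2 * pi * (x ^ 3 / ((N k ^ 4 - x ^ 4) * (sinh (pi * N k))\<^sup>2))"
      using regroup[of "ct (N k)" "u k" "v k"] by (simp only:)
  qed
  moreover have "1 / (2 * pi) * (pi * ct x * (pi\<^sup>2 / (sin (pi * x))\<^sup>2) - 1 / x ^ 3 - 2 * pi\<^sup>2 / (3 * x))
      - 1 / 2 * (pi\<^sup>2 / (sin (pi * x))\<^sup>2 - 1 / x\<^sup>2 - 2 * Polygamma 1 (x + 1)) =
    Polygamma 1 (x + 1) + pi\<^sup>2 / ((sin (pi * x))\<^sup>2 * (exp (2 * pi * x) - 1))
      - 1 / (2 * pi * x ^ 3) - pi / (3 * x) + 1 / (2 * x\<^sup>2)"
  proof -
    have "pi\<^sup>2 / ((sin (pi * x))\<^sup>2 * (exp (2 * pi * x) - 1)) = pi\<^sup>2 / (sin (pi * x))\<^sup>2 * (1 / (exp (2 * pi * x) - 1))"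
      by simp
    also have "\<dots> = pi\<^sup>2 / (sin (pi * x))\<^sup>2 * ((ct x - 1) / 2)"
      by (simp only: ct[OF x(1)])
    finally show ?thesis
      using regroup2[of "ct x" "pi\<^sup>2 / (sin (pi * x))\<^sup>2" "Polygamma 1 (x + 1)"] by (simp only:)
  qed
  ultimately show ?thesis
    using sums unfolding N_def by (simp only:)
qed

section \<open>The trigonometric series\<close>

text \<open>The compact interval with a uniform distance \<open>d\<close> from the singularities
  supplies the locally uniform majorants for differentiating the series.\<close>

lemma not_Int_neighbourhood:
  fixes x :: real
  assumes "x \<notin> \<int>" "x > 0"
  obtains a b d where "0 < a" "a < x" "x < b" "0 < d" "\<And>y. a \<le> y \<Longrightarrow> y \<le> b \<Longrightarrow> y \<notin> \<int>"
    "\<And>y n. a \<le> y \<Longrightarrow> y \<le> b \<Longrightarrow> d \<le> \<bar>real n - y\<bar>"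
proof -
  have "open (- \<int> \<inter> {0::real<..})"
    by (intro open_Int) (auto simp: open_Compl)
  then obtain e where e: "e > 0" "ball x e \<subseteq> - \<int> \<inter> {0<..}"
    using assms by (meson ComplI IntI greaterThan_iff openE)
  show ?thesis
  \<comment> \<open>Thirds leave room: a number closer than e/3 to a point of the interval is still
    closer than e to \<open>x\<close>.\<close>
  proof (rule that[of "x - e / 3" "x + e / 3" "e / 3"])
    have "x - e / 3 \<in> ball x e" using e(1) by (simp add: dist_real_def)
    then have "x - e / 3 \<in> - \<int> \<inter> {0<..}" using e(2) by (rule subsetD[rotated])
    then show "0 < x - e / 3" by simp
    show "y \<notin> \<int>" if "x - e / 3 \<le> y" "y \<le> x + e / 3" for y
    proof -
      have "y \<in> ball x e" using that e(1) by (simp add: dist_real_def abs_less_iff)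
      then show ?thesis using e(2) by auto
    qed
    show "e / 3 \<le> \<bar>real n - y\<bar>" if "x - e / 3 \<le> y" "y \<le> x + e / 3" for y n
    proof (rule ccontr)
      assume "\<not> e / 3 \<le> \<bar>real n - y\<bar>"
      then have "real n \<in> ball x e"
        using that e(1) unfolding mem_ball dist_real_def by linarith
      then show False using e(2) by auto
    qed
  qed (use e in auto)
qed

text \<open>Since y^(p + 2) / exp(c y) tends to 0, the terms are eventually below 1/y^2. Nearly all
  exponential majorants below are put into exactly this shape, which explains their explicit
  \<open>^ 0\<close>, \<open>^ 1\<close> and \<open>1 *\<close>.\<close>

lemma summable_power_times_exp:
  fixes c :: real
  assumes "c > 0"
  shows "summable (\<lambda>k. A * (real (Suc k) ^ p * exp (- (c * real (Suc k)))))"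
proof (rule summable_mult)
  have "((\<lambda>y. y ^ (p + 2) / exp y) \<longlongrightarrow> 0) (at_top :: real filter)"
    by (rule tendsto_power_div_exp_0)
  moreover have "filterlim (\<lambda>k. c * real (Suc k)) at_top sequentially"
    using assms by real_asymp
  ultimately have "(\<lambda>k. (c * real (Suc k)) ^ (p + 2) / exp (c * real (Suc k))) \<longlonglongrightarrow> 0"
    by (rule filterlim_compose)
  then have "\<forall>\<^sub>F k in sequentially. (c * real (Suc k)) ^ (p + 2) / exp (c * real (Suc k)) < c ^ (p + 2)"
    using assms by (intro order_tendstoD) auto
  then have "\<forall>\<^sub>F k in sequentially. norm (real (Suc k) ^ p * exp (- (c * real (Suc k)))) \<le> 1 / (real (Suc k))\<^sup>2"
  proof eventually_elim
    case (elim k)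
    define y where "y = real (Suc k)"
    have "y > 0" by (simp add: y_def)
    have "c ^ (p + 2) * (y ^ (p + 2) / exp (c * y)) < c ^ (p + 2) * 1"
      using elim unfolding y_def[symmetric] by (simp add: power_mult_distrib del: power_Suc)
    then have "y ^ (p + 2) / exp (c * y) < 1"
      using assms by (subst (asm) mult_less_cancel_left_pos) auto
    then have "y ^ p * y\<^sup>2 / exp (c * y) < 1"
      by (simp only: power_add)
    then show ?case
      unfolding y_def[symmetric] using \<open>y > 0\<close> by (simp add: exp_minus field_simps)
  qed
  then show "summable (\<lambda>k. real (Suc k) ^ p * exp (- (c * real (Suc k))))"
    by (rule summable_comparison_test_ev[OF _ summable_inverse_squares])
qed

text \<open>Real part of -Ln(1 - z) at z = r exp(i t), with |1 - z|^2 = 1 - 2 r cos t + r^2.\<close>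

lemma cos_power_series_sums:
  fixes r t :: real
  assumes r: "0 < r" "r < 1"
  shows "(\<lambda>n. r ^ Suc n * cos (real (Suc n) * t) / real (Suc n)) sums (- (ln (1 - 2 * r * cos t + r\<^sup>2) / 2))"
proof -
  define z where "z = of_real r * cis t"
  have "cmod z < 1" using r by (simp add: z_def norm_mult)
  then have "(\<lambda>n. - ((- (- z)) ^ n) / of_nat n) sums Ln (1 + - z)"
    by (intro Ln_series') simp
  then have "(\<lambda>n. - (z ^ Suc n) / of_nat (Suc n)) sums Ln (1 - z)"
    by (subst sums_Suc_iff) simp
  then have "(\<lambda>n. - Re (- (z ^ Suc n) / of_nat (Suc n))) sums - Re (Ln (1 - z))"
    by (intro sums_minus sums_Re)
  also have "(\<lambda>n. - Re (- (z ^ Suc n) / of_nat (Suc n))) = (\<lambda>n. r ^ Suc n * cos (real (Suc n) * t) / real (Suc n))"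
  proof
    fix n
    have "z ^ Suc n = of_real (r ^ Suc n) * cis (real (Suc n) * t)"
      unfolding z_def power_mult_distrib Complex.DeMoivre by simp
    then have "Re (z ^ Suc n) = r ^ Suc n * cos (real (Suc n) * t)"
      by (simp only: Re_complex_of_real Im_complex_of_real times_complex.simps cis.simps)
    then show "- Re (- (z ^ Suc n) / of_nat (Suc n)) = r ^ Suc n * cos (real (Suc n) * t) / real (Suc n)"
      by (simp only: Re_divide_of_nat uminus_complex.simps)
  qed
  also have "- Re (Ln (1 - z)) = - (ln (1 - 2 * r * cos t + r\<^sup>2) / 2)"
  proof -
    have "1 - z \<noteq> 0" using \<open>cmod z < 1\<close> by auto
    have "(cmod (1 - z))\<^sup>2 = 1 - 2 * r * cos t + r\<^sup>2"
    proof -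
      have "(cmod (1 - z))\<^sup>2 = (1 - r * cos t)\<^sup>2 + (r * sin t)\<^sup>2"
        unfolding cmod_power2 z_def by simp
      also have "\<dots> = 1 - 2 * r * cos t + r\<^sup>2 * ((sin t)\<^sup>2 + (cos t)\<^sup>2)"
        by algebra
      finally show ?thesis by simp
    qed
    moreover have "ln ((cmod (1 - z))\<^sup>2) = 2 * ln (cmod (1 - z))"
      using \<open>1 - z \<noteq> 0\<close> by (simp add: ln_realpow)
    ultimately show ?thesis
      using \<open>1 - z \<noteq> 0\<close> by (simp add: Re_Ln)
  qed
  finally show ?thesis .
qed

lemma DERIV_Clausen:
  fixes x :: real
  assumes x: "x \<notin> \<int>" "x > 0"
  shows "((\<lambda>x. \<Sum>n. sin (2 * pi * real (Suc n) * x) / (real (Suc n))\<^sup>2) has_real_derivative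
    - (2 * pi * ln \<bar>2 * sin (pi * x)\<bar>)) (at x)"
proof -
  from not_Int_neighbourhood[OF x] obtain a b
    where ab: "0 < a" "a < x" "x < b" and ni: "\<And>y. a \<le> y \<Longrightarrow> y \<le> b \<Longrightarrow> y \<notin> \<int>"
    by metis
  have sin_nz: "sin (pi * y) \<noteq> 0" if "a \<le> y" "y \<le> b" for y
    using ni[OF that] by (metis mult.commute sin_times_pi_eq_0)
  \<comment> \<open>The minimum \<open>d\<close> of 4 sin^2(pi y) on the interval is positive; it
    makes the estimate of the logarithms uniform in \<open>y\<close>.\<close>
  have "\<exists>y0\<in>{a..b}. \<forall>y\<in>{a..b}. 4 * (sin (pi * y0))\<^sup>2 \<le> 4 * (sin (pi * y))\<^sup>2"
    by (rule continuous_attains_inf) (use ab in \<open>auto intro!: continuous_intros\<close>)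
  then obtain y0 where y0: "y0 \<in> {a..b}" "\<And>y. y \<in> {a..b} \<Longrightarrow> 4 * (sin (pi * y0))\<^sup>2 \<le> 4 * (sin (pi * y))\<^sup>2"
    by blast
  define d where "d = 4 * (sin (pi * y0))\<^sup>2"
  have d: "d > 0" using sin_nz[of y0] y0(1) by (simp add: d_def)
  \<comment> \<open>Abel summation: the derivatives for \<open>r < 1\<close> converge locally uniformly as \<open>r \<rightarrow> 1\<close>, which
    avoids the conditionally convergent series of \<open>cos (2\<pi>nx) / n\<close>.\<close>
  define r where "r n = 1 - 1 / (real n + 2)" for n
  have r: "0 < r n" "r n < 1" for n by (auto simp: r_def field_simps)
  have r_lim: "r \<longlonglongrightarrow> 1" unfolding r_def by real_asymp
  define f where "f n y = (\<Sum>k. r n ^ Suc k * sin (2 * pi * real (Suc k) * y) / (real (Suc k))\<^sup>2)" for n y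
  define f' where "f' n y = - (pi * ln (1 - 2 * r n * cos (2 * pi * y) + (r n)\<^sup>2))" for n y
  have abs_r: "\<bar>r n ^ Suc k * c\<bar> \<le> r n ^ Suc k" if "\<bar>c\<bar> \<le> 1" for n k c
    using that r[of n] by (simp add: abs_mult mult_left_le)
  have le1: "\<bar>r n ^ Suc k * sin (2 * pi * real (Suc k) * y) / (real (Suc k))\<^sup>2\<bar> \<le> 1 / (real (Suc k))\<^sup>2" for n k y
  proof -
    have "r n ^ Suc k \<le> 1" using r[of n] by (intro power_le_one) auto
    then have "\<bar>r n ^ Suc k * sin (2 * pi * real (Suc k) * y)\<bar> \<le> 1"
      using abs_r[of "sin (2 * pi * real (Suc k) * y)" n k] by (meson abs_sin_le_one order_trans)
    then show ?thesis
      by (simp add: divide_right_mono)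
  qed
  have der: "(f n has_real_derivative f' n y) (at y)" for n y
  proof -
    define g' where "g' k y = 2 * pi * (r n ^ Suc k * cos (real (Suc k) * (2 * pi * y)) / real (Suc k))" for k y
    have "((\<lambda>y. \<Sum>k. r n ^ Suc k * sin (2 * pi * real (Suc k) * y) / (real (Suc k))\<^sup>2)
      has_real_derivative (\<Sum>k. g' k y)) (at y)"
    proof (rule DERIV_suminf_dominated[where a = "y - 1" and b = "y + 1" and M = "\<lambda>k. 2 * pi * r n ^ Suc k"])
      fix k z
      have "((\<lambda>y. r n ^ Suc k * sin (2 * pi * real (Suc k) * y) / (real (Suc k))\<^sup>2) has_real_derivative
        r n ^ Suc k * (cos (2 * pi * real (Suc k) * z) * (2 * pi * real (Suc k))) / (real (Suc k))\<^sup>2) (at z)"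
        by (rule DERIV_cdivide) (auto intro!: derivative_eq_intros simp del: of_nat_Suc power_Suc)
      then show "((\<lambda>y. r n ^ Suc k * sin (2 * pi * real (Suc k) * y) / (real (Suc k))\<^sup>2) has_real_derivative g' k z) (at z)"
        by (simp add: g'_def power2_eq_square mult_ac del: of_nat_Suc power_Suc)
      have "\<bar>r n ^ Suc k * cos (real (Suc k) * (2 * pi * z)) / real (Suc k)\<bar> \<le> r n ^ Suc k / 1"
        using abs_r[of "cos (real (Suc k) * (2 * pi * z))" n k]
        unfolding abs_divide by (intro frac_le) auto
      then show "\<bar>g' k z\<bar> \<le> 2 * pi * r n ^ Suc k"
        unfolding g'_def abs_mult[of "2 * pi"] by (intro mult_mono) auto
    next
      have "summable (\<lambda>k. 2 * pi * r n * r n ^ k)"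
        using r[of n] by (intro summable_mult summable_geometric) auto
      then show "summable (\<lambda>k. 2 * pi * r n ^ Suc k)" by (simp add: mult.assoc)
    next
      show "summable (\<lambda>k. r n ^ Suc k * sin (2 * pi * real (Suc k) * y) / (real (Suc k))\<^sup>2)"
        by (rule summable_comparison_test'[OF summable_inverse_squares, of 0]) (use le1 in \<open>simp only: real_norm_def\<close>)
    qed auto
    also have "(\<Sum>k. g' k y) = f' n y"
      using sums_mult[OF cos_power_series_sums[OF r, of n "2 * pi * y"], of "2 * pi"]
      by (simp add: g'_def f'_def sums_iff del: of_nat_Suc power_Suc)
    finally show ?thesis unfolding f_def .
  qed
  have unif: "\<forall>\<^sub>F n in sequentially. \<forall>y\<in>{a..b}. \<forall>h. norm (f' n y * h - - (2 * pi * ln \<bar>2 * sin (pi * y)\<bar>) * h) \<le> e * norm h"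
    if "e > 0" for e
  proof -
    have "(\<lambda>n. pi * (- ln (r n) + (1 - r n)\<^sup>2 / d)) \<longlonglongrightarrow> pi * (- ln 1 + (1 - 1)\<^sup>2 / d)"
      using d by (intro tendsto_intros r_lim) auto
    then have "\<forall>\<^sub>F n in sequentially. pi * (- ln (r n) + (1 - r n)\<^sup>2 / d) < e"
      using that by (intro order_tendstoD) auto
    then show ?thesis
    proof (eventually_elim, intro ballI allI)
      fix n y h assume n: "pi * (- ln (r n) + (1 - r n)\<^sup>2 / d) < e" and y: "y \<in> {a..b}"
      define s where "s = 4 * (sin (pi * y))\<^sup>2"
      have s: "s \<ge> d" "s > 0" using y0(2)[OF y] d by (auto simp: s_def d_def)
      have cos_s: "cos (2 * pi * y) = 1 - s / 2"
        using cos_double_sin[of "pi * y"] by (simp add: s_def mult.assoc)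
      \<comment> \<open>The argument of the logarithm is compared with its limit \<open>s\<close> as
        r tends to 1. The ratio r + (1 - r)^2/s is at least r and at most r + (1 - r)^2/d, so its
        logarithm tends to 0 uniformly on the interval.\<close>
      then have eq: "1 - 2 * r n * cos (2 * pi * y) + (r n)\<^sup>2 = s * (r n + (1 - r n)\<^sup>2 / s)"
        unfolding cos_s using s by (simp add: field_simps power2_eq_square)
      have pos: "r n + (1 - r n)\<^sup>2 / s > 0"
        using r[of n] s by (intro add_pos_nonneg) auto
      have ln_s: "ln s = 2 * ln \<bar>2 * sin (pi * y)\<bar>"
      proof -
        have "s = \<bar>2 * sin (pi * y)\<bar>\<^sup>2" by (simp add: s_def power_mult_distrib)
        then have "ln s = ln (\<bar>2 * sin (pi * y)\<bar>\<^sup>2)" by (simp only:)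
        also have "\<dots> = 2 * ln \<bar>2 * sin (pi * y)\<bar>"
          by (subst ln_realpow) (use sin_nz[of y] y in auto)
        finally show ?thesis .
      qed
      then have diff: "f' n y - - (2 * pi * ln \<bar>2 * sin (pi * y)\<bar>) = - (pi * ln (r n + (1 - r n)\<^sup>2 / s))"
        unfolding f'_def eq ln_mult_pos[OF s(2) pos] ln_s by (simp add: right_diff_distrib distrib_left)
      have "ln (r n + (1 - r n)\<^sup>2 / s) \<le> r n + (1 - r n)\<^sup>2 / s - 1"
        using pos by (rule ln_le_minus_one)
      also have "\<dots> \<le> (1 - r n)\<^sup>2 / d"
        using r[of n] s d frac_le[of "(1 - r n)\<^sup>2" "(1 - r n)\<^sup>2" d s] by simp
      finally have up: "ln (r n + (1 - r n)\<^sup>2 / s) \<le> (1 - r n)\<^sup>2 / d" .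
      have lo: "ln (r n) \<le> ln (r n + (1 - r n)\<^sup>2 / s)"
        using r[of n] pos s by simp
      have "ln (r n) \<le> 0" "(1 - r n)\<^sup>2 / d \<ge> 0" using r[of n] d by auto
      then have "\<bar>ln (r n + (1 - r n)\<^sup>2 / s)\<bar> \<le> - ln (r n) + (1 - r n)\<^sup>2 / d"
        using up lo by linarith
      then have "pi * \<bar>ln (r n + (1 - r n)\<^sup>2 / s)\<bar> \<le> pi * (- ln (r n) + (1 - r n)\<^sup>2 / d)"
        by (intro mult_left_mono) auto
      then have "pi * \<bar>ln (r n + (1 - r n)\<^sup>2 / s)\<bar> \<le> e"
        using n by linarith
      then have "\<bar>f' n y - - (2 * pi * ln \<bar>2 * sin (pi * y)\<bar>)\<bar> \<le> e"
        unfolding diff by (simp add: abs_mult)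
      then have "\<bar>f' n y - - (2 * pi * ln \<bar>2 * sin (pi * y)\<bar>)\<bar> * \<bar>h\<bar> \<le> e * \<bar>h\<bar>"
        by (rule mult_right_mono) simp
      then show "norm (f' n y * h - - (2 * pi * ln \<bar>2 * sin (pi * y)\<bar>) * h) \<le> e * norm h"
        by (simp only: real_norm_def left_diff_distrib[symmetric] abs_mult)
    qed
  qed
  have lim: "(\<lambda>n. f n y) \<longlonglongrightarrow> (\<Sum>k. sin (2 * pi * real (Suc k) * y) / (real (Suc k))\<^sup>2)" for y
    unfolding f_def
  proof (rule tendsto_suminf_dominated[OF _ _ summable_inverse_squares[of 1]])
    fix k
    have "(\<lambda>n. r n ^ Suc k * sin (2 * pi * real (Suc k) * y) / (real (Suc k))\<^sup>2) \<longlonglongrightarrow>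
       1 ^ Suc k * sin (2 * pi * real (Suc k) * y) / (real (Suc k))\<^sup>2"
      by (intro tendsto_intros r_lim) simp
    then show "(\<lambda>n. r n ^ Suc k * sin (2 * pi * real (Suc k) * y) / (real (Suc k))\<^sup>2) \<longlonglongrightarrow>
       sin (2 * pi * real (Suc k) * y) / (real (Suc k))\<^sup>2" by (simp only: power_one mult_1)
  qed (use le1 in auto)
  have "\<exists>g. \<forall>y\<in>{a..b}. (\<lambda>n. f n y) \<longlonglongrightarrow> g y \<and>
      (g has_derivative (\<lambda>h. - (2 * pi * ln \<bar>2 * sin (pi * y)\<bar>) * h)) (at y within {a..b})"
  proof (rule has_derivative_sequence[where f' = "\<lambda>n y h. f' n y * h" and ?x0.0 = x, OF _ _ unif _ lim])
    show "(f n has_derivative (*) (f' n y)) (at y within {a..b})" for n y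
      using der[of n y] unfolding has_field_derivative_def by (rule has_derivative_at_withinI)
  qed (use ab in auto)
  then obtain g where g: "\<And>y. y \<in> {a..b} \<Longrightarrow> (\<lambda>n. f n y) \<longlonglongrightarrow> g y"
      "\<And>y. y \<in> {a..b} \<Longrightarrow> (g has_real_derivative - (2 * pi * ln \<bar>2 * sin (pi * y)\<bar>)) (at y within {a..b})"
    unfolding has_field_derivative_def by blast
  have "(g has_real_derivative - (2 * pi * ln \<bar>2 * sin (pi * x)\<bar>)) (at x)"
    using g(2)[of x] ab by (simp add: at_within_Icc_at)
  then show ?thesis
  proof (rule has_field_derivative_transform_within_open[where S = "{a<..<b}"])
    show "g y = (\<Sum>n. sin (2 * pi * real (Suc n) * y) / (real (Suc n))\<^sup>2)" if "y \<in> {a<..<b}" for y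
      using g(1)[of y] lim[of y] that by (intro LIMSEQ_unique) auto
  qed (use ab in auto)
qed

section \<open>The inner sine and cosine series and their derivatives\<close>

lemma abs_sin_term_le: "\<bar>sin_term x k (Suc n)\<bar> \<le> 1 / (real (Suc n))\<^sup>2"
  and abs_cos_term_le: "\<bar>cos_term x k (Suc n)\<bar> \<le> 1 / (real (Suc n))\<^sup>2"
proof -
  define m where "m = real (Suc n)"
  have m: "m \<ge> 1" "m\<^sup>2 > 0" "(real k)\<^sup>2 + m\<^sup>2 \<ge> m\<^sup>2" by (auto simp: m_def)
  then have m': "m * ((real k)\<^sup>2 + m\<^sup>2) \<ge> 1 * m\<^sup>2" by (intro mult_mono) auto
  show "\<bar>sin_term x k (Suc n)\<bar> \<le> 1 / (real (Suc n))\<^sup>2"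
    unfolding sin_term_def m_def[symmetric] abs_divide using m by (intro frac_le) auto
  show "\<bar>cos_term x k (Suc n)\<bar> \<le> 1 / (real (Suc n))\<^sup>2"
    unfolding cos_term_def m_def[symmetric] abs_divide using m m' by (intro frac_le) auto
qed

lemma summable_sin_term: "summable (\<lambda>n. sin_term x k (Suc n))"
  by (rule summable_comparison_test'[OF summable_inverse_squares[of 1], of 0])
     (simp only: real_norm_def abs_sin_term_le)

lemma summable_cos_term: "summable (\<lambda>n. cos_term x k (Suc n))"
  by (rule summable_comparison_test'[OF summable_inverse_squares[of 1], of 0])
     (simp only: real_norm_def abs_cos_term_le)

lemma abs_suminf_sin_term_le: "\<bar>\<Sum>n. sin_term x k (Suc n)\<bar> \<le> 2"
  and abs_suminf_cos_term_le: "\<bar>\<Sum>n. cos_term x k (Suc n)\<bar> \<le> 2"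
proof -
  have sums: "(\<lambda>n. 1 / (real (Suc n))\<^sup>2) sums (pi\<^sup>2 / 6)"
    using inverse_squares_sums by (simp add: add.commute)
  have "pi\<^sup>2 \<le> 3.2\<^sup>2" using pi_approx by (intro power_mono) auto
  then have "pi\<^sup>2 / 6 \<le> 2" by (simp add: power2_eq_square)
  then have le: "\<bar>\<Sum>n. f n\<bar> \<le> 2" if "\<And>n. \<bar>f n\<bar> \<le> 1 / (real (Suc n))\<^sup>2" for f :: "nat \<Rightarrow> real"
    using norm_sums_le[OF _ sums, of f "suminf f"] that
      summable_comparison_test'[OF summable_inverse_squares, of 0 f 1] by (force simp: summable_sums)
  show "\<bar>\<Sum>n. sin_term x k (Suc n)\<bar> \<le> 2" "\<bar>\<Sum>n. cos_term x k (Suc n)\<bar> \<le> 2"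
    by (rule le, rule abs_sin_term_le abs_cos_term_le)+
qed

lemma DERIV_suminf_cos_term:
  "((\<lambda>x. \<Sum>n. cos_term x k (Suc n)) has_real_derivative - (2 * pi * (\<Sum>n. sin_term x k (Suc n)))) (at x)"
proof -
  have "((\<lambda>x. \<Sum>n. cos_term x k (Suc n)) has_real_derivative (\<Sum>n. - (2 * pi * sin_term x k (Suc n)))) (at x)"
  proof (rule DERIV_suminf_dominated[where a = "x - 1" and b = "x + 1", OF _ _ summable_inverse_squares summable_cos_term])
    fix n y
    define m c where "m = real (Suc n)" and "c = (real k)\<^sup>2 + m\<^sup>2"
    have "m > 0" by (simp add: m_def)
    then have "c > 0" by (auto simp: c_def intro!: add_nonneg_pos)
    have "((\<lambda>y. cos (2 * pi * m * y) / (m * c)) has_real_derivative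
        - sin (2 * pi * m * y) * (2 * pi * m) / (m * c)) (at y)"
      by (rule DERIV_cdivide) (auto intro!: derivative_eq_intros)
    also have "- sin (2 * pi * m * y) * (2 * pi * m) / (m * c) = - (2 * pi * (sin (2 * pi * m * y) / c))"
      using \<open>m > 0\<close> by simp
    finally show "((\<lambda>x. cos_term x k (Suc n)) has_real_derivative - (2 * pi * sin_term y k (Suc n))) (at y)"
      unfolding cos_term_def sin_term_def c_def m_def .
    have "2 * pi * \<bar>sin_term y k (Suc n)\<bar> \<le> 2 * pi * (1 / (real (Suc n))\<^sup>2)"
      by (intro mult_left_mono abs_sin_term_le) auto
    then show "\<bar>- (2 * pi * sin_term y k (Suc n))\<bar> \<le> 2 * pi / (real (Suc n))\<^sup>2"
      by (simp add: abs_mult)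
  qed auto
  then show ?thesis
    by (simp add: suminf_minus suminf_mult summable_sin_term summable_mult)
qed

text \<open>Splitting 1/(k^2 + n^2) = 1/n^2 - k^2/(n^2 (k^2 + n^2)) isolates the slowly convergent
  part as the Clausen series. The remainder \<open>Q\<close> may be differentiated termwise with a
  majorant of order 1/n^2.\<close>

lemma DERIV_suminf_sin_term:
  assumes x: "x \<notin> \<int>" "x > 0"
  shows "((\<lambda>x. \<Sum>n. sin_term x k (Suc n)) has_real_derivative
    - (2 * pi * ln \<bar>2 * sin (pi * x)\<bar>) - 2 * pi * (real k)\<^sup>2 * (\<Sum>n. cos_term x k (Suc n))) (at x)"
proof -
  define Q where "Q y n = sin (2 * pi * real (Suc n) * y) / ((real (Suc n))\<^sup>2 * ((real k)\<^sup>2 + (real (Suc n))\<^sup>2))" for y n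
  define Cl where "Cl y n = sin (2 * pi * real (Suc n) * y) / (real (Suc n))\<^sup>2" for y n
  have Cl_le: "\<bar>Cl y n\<bar> \<le> 1 / (real (Suc n))\<^sup>2" for y n
    unfolding Cl_def abs_divide by (intro frac_le) auto
  have sCl: "summable (Cl y)" for y
    by (rule summable_comparison_test'[OF summable_inverse_squares[of 1], of 0]) (simp only: real_norm_def Cl_le)
  have Q_le: "\<bar>Q y n\<bar> \<le> 1 / (real (Suc n))\<^sup>2" for y n
  proof -
    define m where "m = real (Suc n)"
    have "m \<ge> 1" by (simp add: m_def)
    then have "m\<^sup>2 \<ge> 1\<^sup>2" by (intro power_mono) auto
    then have "m\<^sup>2 * 1 \<le> m\<^sup>2 * ((real k)\<^sup>2 + m\<^sup>2)" by (intro mult_left_mono) (auto intro: add_increasing)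
    then show ?thesis
      unfolding Q_def m_def[symmetric] abs_divide using \<open>m \<ge> 1\<close> by (intro frac_le) auto
  qed
  have sQ: "summable (Q y)" for y
    by (rule summable_comparison_test'[OF summable_inverse_squares[of 1], of 0]) (simp only: real_norm_def Q_le)
  have split: "sin_term y k (Suc n) = Cl y n - (real k)\<^sup>2 * Q y n" for y n
  proof -
    define m c where "m = real (Suc n)" and "c = (real k)\<^sup>2 + m\<^sup>2"
    have "m > 0" by (simp add: m_def)
    then have "c > 0" by (auto simp: c_def intro!: add_nonneg_pos)
    have "s / c = s / m\<^sup>2 - (c - m\<^sup>2) * (s / (m\<^sup>2 * c))" for s
      using \<open>m > 0\<close> \<open>c > 0\<close> by (simp add: field_simps)
    then show ?thesis
      unfolding sin_term_def Cl_def Q_def m_def[symmetric] c_def[symmetric] by (simp add: c_def)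
  qed
  have "((\<lambda>y. \<Sum>n. Q y n) has_real_derivative (\<Sum>n. 2 * pi * cos_term x k (Suc n))) (at x)"
  proof (rule DERIV_suminf_dominated[where a = "x - 1" and b = "x + 1", OF _ _ summable_inverse_squares sQ])
    fix n y
    define m c where "m = real (Suc n)" and "c = (real k)\<^sup>2 + m\<^sup>2"
    have "m > 0" by (simp add: m_def)
    then have "c > 0" by (auto simp: c_def intro!: add_nonneg_pos)
    have "((\<lambda>y. sin (2 * pi * m * y) / (m\<^sup>2 * c)) has_real_derivative
        cos (2 * pi * m * y) * (2 * pi * m) / (m\<^sup>2 * c)) (at y)"
      by (rule DERIV_cdivide) (auto intro!: derivative_eq_intros)
    also have "cos (2 * pi * m * y) * (2 * pi * m) / (m\<^sup>2 * c) = 2 * pi * (cos (2 * pi * m * y) / (m * c))"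
      using \<open>m > 0\<close> by (simp add: power2_eq_square)
    finally show "((\<lambda>y. Q y n) has_real_derivative 2 * pi * cos_term y k (Suc n)) (at y)"
      unfolding cos_term_def Q_def c_def m_def .
    have "2 * pi * \<bar>cos_term y k (Suc n)\<bar> \<le> 2 * pi * (1 / (real (Suc n))\<^sup>2)"
      by (intro mult_left_mono abs_cos_term_le) auto
    then show "\<bar>2 * pi * cos_term y k (Suc n)\<bar> \<le> 2 * pi / (real (Suc n))\<^sup>2"
      by (simp add: abs_mult)
  qed auto
  then have "((\<lambda>y. \<Sum>n. Q y n) has_real_derivative 2 * pi * (\<Sum>n. cos_term x k (Suc n))) (at x)"
    by (simp add: suminf_mult summable_cos_term)
  from DERIV_diff[OF DERIV_Clausen[OF x] DERIV_cmult[OF this, of "(real k)\<^sup>2"]]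
  have "((\<lambda>y. (\<Sum>n. Cl y n) - (real k)\<^sup>2 * (\<Sum>n. Q y n)) has_real_derivative
    - (2 * pi * ln \<bar>2 * sin (pi * x)\<bar>) - (real k)\<^sup>2 * (2 * pi * (\<Sum>n. cos_term x k (Suc n)))) (at x)"
    unfolding Cl_def .
  also have "(\<lambda>y. (\<Sum>n. Cl y n) - (real k)\<^sup>2 * (\<Sum>n. Q y n)) = (\<lambda>y. \<Sum>n. sin_term y k (Suc n))"
    unfolding split by (simp add: suminf_diff[symmetric] suminf_mult summable_mult sCl sQ)
  finally show ?thesis by (simp only: mult_ac)
qed

text \<open>In the product rule the coefficient of S is -2 pi k^3 + 2 pi k^3 and that of C is 2 pi
  k^4 - 2 pi k^4. Only the forcing term -2 pi k^2 L survives.\<close>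

lemma DERIV_trig_term:
  assumes x: "x \<notin> \<int>" "x > 0"
  shows "((\<lambda>x. trig_term x k) has_real_derivative
    - (2 * pi * ln \<bar>2 * sin (pi * x)\<bar> * ((real k)\<^sup>2 * exp (- (2 * pi * x * real k))))) (at x)"
proof -
  define L where "L = ln \<bar>2 * sin (pi * x)\<bar>"
  define S C where "S = (\<lambda>x. \<Sum>n. sin_term x k (Suc n))" and "C = (\<lambda>x. \<Sum>n. cos_term x k (Suc n))"
  have S: "(S has_real_derivative - (2 * pi * L) - 2 * pi * (real k)\<^sup>2 * C x) (at x)"
    unfolding S_def C_def L_def by (rule DERIV_suminf_sin_term[OF x])
  have C: "(C has_real_derivative - (2 * pi * S x)) (at x)"
    unfolding S_def C_def by (rule DERIV_suminf_cos_term)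
  have "((\<lambda>x. exp (- 2 * pi * real k * x) * ((real k)\<^sup>2 * S x - real k ^ 3 * C x)) has_real_derivative
    - (2 * pi * L * ((real k)\<^sup>2 * exp (- (2 * pi * x * real k))))) (at x)"
    by (rule derivative_eq_intros S C refl)+
       (simp add: algebra_simps power2_eq_square power3_eq_cube)
  then show ?thesis
    unfolding trig_term_def S_def C_def L_def .
qed

lemma abs_trig_term_le:
  assumes "0 < a" "a \<le> x" "k \<ge> 1"
  shows "\<bar>trig_term x k\<bar> \<le> 4 * (real k ^ 3 * exp (- (2 * pi * a * real k)))"
proof -
  define S C where "S = (\<Sum>n. sin_term x k (Suc n))" and "C = (\<Sum>n. cos_term x k (Suc n))"
  have "\<bar>(real k)\<^sup>2 * S - real k ^ 3 * C\<bar> \<le> (real k)\<^sup>2 * \<bar>S\<bar> + real k ^ 3 * \<bar>C\<bar>"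
    by (rule order_trans[OF abs_triangle_ineq4]) (simp add: abs_mult)
  also have "\<dots> \<le> real k ^ 3 * 2 + real k ^ 3 * 2"
    using assms unfolding S_def C_def
    by (intro add_mono mult_mono abs_suminf_sin_term_le abs_suminf_cos_term_le power_increasing) auto
  finally have "\<bar>(real k)\<^sup>2 * S - real k ^ 3 * C\<bar> \<le> 4 * real k ^ 3" by simp
  moreover have "exp (- 2 * pi * real k * x) \<le> exp (- (2 * pi * a * real k))"
    using assms by (simp add: mult_mono)
  ultimately have "exp (- 2 * pi * real k * x) * \<bar>(real k)\<^sup>2 * S - real k ^ 3 * C\<bar> \<le>
      exp (- (2 * pi * a * real k)) * (4 * real k ^ 3)"
    by (intro mult_mono) auto
  then show ?thesis
    unfolding trig_term_def S_def C_def by (simp add: abs_mult mult_ac)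
qed

lemma summable_trig_term:
  assumes "x > 0"
  shows "summable (\<lambda>k. trig_term x (Suc k))"
proof (rule summable_comparison_test'[where N = 0])
  show "summable (\<lambda>k. 4 * (real (Suc k) ^ 3 * exp (- (2 * pi * x * real (Suc k)))))"
    using assms by (intro summable_power_times_exp) simp
  show "norm (trig_term x (Suc k)) \<le> 4 * (real (Suc k) ^ 3 * exp (- (2 * pi * x * real (Suc k))))" for k
    unfolding real_norm_def using assms by (intro abs_trig_term_le) auto
qed

lemma isCont_trig_term: "isCont (\<lambda>x. trig_term x k) x"
proof -
  have C: "isCont (\<lambda>x. \<Sum>n. cos_term x k (Suc n)) x"
    by (rule DERIV_isCont[OF DERIV_suminf_cos_term])
  have S: "isCont (\<lambda>x. \<Sum>n. sin_term x k (Suc n)) x"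
    unfolding isCont_def
  proof (rule tendsto_suminf_dominated[OF _ _ summable_inverse_squares[of 1]])
    show "(\<lambda>x. sin_term x k (Suc n)) \<midarrow>x\<rightarrow> sin_term x k (Suc n)" for n
      unfolding sin_term_def
      by (intro tendsto_intros) (simp add: add_nonneg_eq_0_iff)
  qed (use abs_sin_term_le in auto)
  show ?thesis
    unfolding trig_term_def by (intro continuous_intros C S)
qed

lemma isCont_suminf_trig_term:
  assumes "x > 0"
  shows "isCont (\<lambda>x. \<Sum>k. trig_term x (Suc k)) x"
  unfolding isCont_def
proof (rule tendsto_suminf_dominated)
  show "summable (\<lambda>k. 4 * (real (Suc k) ^ 3 * exp (- (2 * pi * (x / 2) * real (Suc k)))))"
    using assms by (intro summable_power_times_exp) simp
  show "(\<lambda>x. trig_term x (Suc k)) \<midarrow>x\<rightarrow> trig_term x (Suc k)" for k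
    using isCont_trig_term by (simp add: isCont_def)
  have "\<forall>\<^sub>F y in at x. y > x / 2"
    using assms by (intro order_tendstoD[OF tendsto_ident_at]) auto
  then show "\<forall>\<^sub>F y in at x. \<forall>k. \<bar>trig_term y (Suc k)\<bar> \<le>
      4 * (real (Suc k) ^ 3 * exp (- (2 * pi * (x / 2) * real (Suc k))))"
  proof eventually_elim
    case (elim y)
    then show ?case using assms by (intro allI abs_trig_term_le) auto
  qed
qed auto

lemma DERIV_suminf_trig_term:
  assumes x: "x \<notin> \<int>" "x > 0"
  shows "((\<lambda>x. \<Sum>k. trig_term x (Suc k)) has_real_derivative
    - (2 * pi * ln \<bar>2 * sin (pi * x)\<bar> * (\<Sum>k. (real (Suc k))\<^sup>2 * exp (- (2 * pi * x * real (Suc k)))))) (at x)"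
proof -
  from not_Int_neighbourhood[OF x] obtain a b
    where ab: "0 < a" "a < x" "x < b" and ni: "\<And>y. a \<le> y \<Longrightarrow> y \<le> b \<Longrightarrow> y \<notin> \<int>"
    by metis
  have sin_nz: "sin (pi * y) \<noteq> 0" if "a \<le> y" "y \<le> b" for y
    using ni[OF that] by (metis mult.commute sin_times_pi_eq_0)
  \<comment> \<open>The singular factor does not depend on \<open>k\<close>: a bound for it on the
    compact interval leaves k^2 exp(-2 pi a k) as majorant.\<close>
  have "bounded ((\<lambda>y. ln \<bar>2 * sin (pi * y)\<bar>) ` {a..b})"
    by (intro compact_imp_bounded compact_continuous_image)
       (use sin_nz in \<open>auto intro!: continuous_intros\<close>)
  then obtain B where B: "B > 0" "\<And>y. a \<le> y \<Longrightarrow> y \<le> b \<Longrightarrow> \<bar>ln \<bar>2 * sin (pi * y)\<bar>\<bar> \<le> B"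
    by (auto simp: bounded_pos)
  have "((\<lambda>x. \<Sum>k. trig_term x (Suc k)) has_real_derivative
    (\<Sum>k. - (2 * pi * ln \<bar>2 * sin (pi * x)\<bar> * ((real (Suc k))\<^sup>2 * exp (- (2 * pi * x * real (Suc k))))))) (at x)"
  proof (rule DERIV_suminf_dominated[where a = a and b = b])
    fix k y assume y: "a \<le> y" "y \<le> b"
    show "((\<lambda>x. trig_term x (Suc k)) has_real_derivative
      - (2 * pi * ln \<bar>2 * sin (pi * y)\<bar> * ((real (Suc k))\<^sup>2 * exp (- (2 * pi * y * real (Suc k)))))) (at y)"
      using y ab ni[OF y] by (intro DERIV_trig_term) auto
    have "\<bar>2 * pi * ln \<bar>2 * sin (pi * y)\<bar>\<bar> * \<bar>(real (Suc k))\<^sup>2 * exp (- (2 * pi * y * real (Suc k)))\<bar> \<le>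
        (2 * pi * B) * ((real (Suc k))\<^sup>2 * exp (- (2 * pi * a * real (Suc k))))"
    proof (intro mult_mono)
      show "\<bar>2 * pi * ln \<bar>2 * sin (pi * y)\<bar>\<bar> \<le> 2 * pi * B"
        using B(2)[OF y] by (simp add: abs_mult)
      show "\<bar>(real (Suc k))\<^sup>2 * exp (- (2 * pi * y * real (Suc k)))\<bar> \<le>
          (real (Suc k))\<^sup>2 * exp (- (2 * pi * a * real (Suc k)))"
        using y by (simp add: abs_mult mult_left_mono mult_right_mono)
    qed (use B in auto)
    then show "\<bar>- (2 * pi * ln \<bar>2 * sin (pi * y)\<bar> * ((real (Suc k))\<^sup>2 * exp (- (2 * pi * y * real (Suc k)))))\<bar> \<le>
        (2 * pi * B) * ((real (Suc k))\<^sup>2 * exp (- (2 * pi * a * real (Suc k))))"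
      by (simp only: abs_minus_cancel abs_mult)
  next
    show "summable (\<lambda>k. (2 * pi * B) * ((real (Suc k))\<^sup>2 * exp (- (2 * pi * a * real (Suc k)))))"
      using ab by (intro summable_power_times_exp) simp
  qed (use ab x summable_trig_term in auto)
  moreover have "summable (\<lambda>k. 1 * ((real (Suc k))\<^sup>2 * exp (- (2 * pi * x * real (Suc k)))))"
    using x by (intro summable_power_times_exp) simp
  ultimately show ?thesis
    by (simp add: suminf_minus suminf_mult summable_mult del: of_nat_Suc)
qed

section \<open>The derivative of the expansion\<close>

text \<open>The crude rate exp(-k) in place of exp(-2 pi k) still beats every power of k, and fits
  \<open>summable_power_times_exp\<close> with c = 1.\<close>

lemma inverse_exp_minus_1_le:
  assumes "k \<ge> 1"
  shows "0 < exp (2 * pi * real k) - 1" "1 / (exp (2 * pi * real k) - 1) \<le> exp (- real k)"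
proof -
  have E: "exp (real k) \<ge> 2"
    using exp_ge_add_one_self[of "real k"] assms by linarith
  then have "exp (real k) + 1 \<le> exp (real k) * exp (real k)"
    using mult_right_mono[of 2 "exp (real k)" "exp (real k)"] by linarith
  also have "\<dots> = exp (2 * real k)" by (simp flip: exp_add)
  also have "\<dots> \<le> exp (2 * pi * real k)"
    using assms pi_gt3 by simp
  finally have *: "exp (real k) \<le> exp (2 * pi * real k) - 1" by simp
  then show pos: "0 < exp (2 * pi * real k) - 1"
    using E by linarith
  have "1 / (exp (2 * pi * real k) - 1) \<le> 1 / exp (real k)"
    using * pos by (intro divide_left_mono) auto
  then show "1 / (exp (2 * pi * real k) - 1) \<le> exp (- real k)"
    by (simp add: exp_minus inverse_eq_divide)
qed

lemma four_sinh_squared: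
  fixes y :: real
  shows "4 * (sinh y)\<^sup>2 = (exp y - 1 / exp y)\<^sup>2" "4 * (sinh y)\<^sup>2 = exp (2 * y) - 2 + exp (- (2 * y))"
proof -
  have "2 * sinh y = exp y - 1 / exp y"
    by (simp add: sinh_field_def exp_minus inverse_eq_divide)
  then have "(2 * sinh y)\<^sup>2 = (exp y - 1 / exp y)\<^sup>2" by (simp only:)
  then show 1: "4 * (sinh y)\<^sup>2 = (exp y - 1 / exp y)\<^sup>2"
    by (simp add: power_mult_distrib)
  also have "\<dots> = exp (2 * y) - 2 + exp (- (2 * y))"
    by (simp add: power2_diff power_divide exp_double exp_minus inverse_eq_divide)
  finally show "4 * (sinh y)\<^sup>2 = exp (2 * y) - 2 + exp (- (2 * y))" .
qed

lemma inverse_sinh_squared_le: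
  assumes "k \<ge> 1"
  shows "0 < (sinh (pi * real k))\<^sup>2" "1 / (sinh (pi * real k))\<^sup>2 \<le> 4 * exp (- real k)"
proof -
  have E: "exp (real k) \<ge> 2"
    using exp_ge_add_one_self[of "real k"] assms by linarith
  have "exp (real k) * 4 \<le> exp (real k) * (exp (real k) * exp (real k))"
    using mult_mono[OF E E] by (intro mult_left_mono) auto
  also have "\<dots> = exp (3 * real k)" by (simp flip: exp_add)
  also have "\<dots> \<le> exp (2 * pi * real k)"
    using assms pi_gt3 by simp
  finally have *: "exp (real k) + 2 \<le> exp (2 * pi * real k)" using E by simp
  have "4 * (sinh (pi * real k))\<^sup>2 = exp (2 * pi * real k) - 2 + exp (- (2 * pi * real k))"
    using four_sinh_squared(2)[of "pi * real k"] by (simp add: mult.assoc)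
  then have **: "exp (real k) / 4 \<le> (sinh (pi * real k))\<^sup>2"
    using * exp_gt_zero[of "- (2 * pi * real k)"] by linarith
  show pos: "0 < (sinh (pi * real k))\<^sup>2"
    using assms by simp
  have "1 / (sinh (pi * real k))\<^sup>2 \<le> 1 / (exp (real k) / 4)"
    using ** pos by (intro divide_left_mono) auto
  then show "1 / (sinh (pi * real k))\<^sup>2 \<le> 4 * exp (- real k)"
    by (simp add: exp_minus inverse_eq_divide)
qed

lemma DERIV_ln_abs:
  fixes x :: real
  assumes "x \<noteq> 0"
  shows "((\<lambda>x. ln \<bar>x\<bar>) has_real_derivative 1 / x) (at x)"
proof (cases "x > 0")
  case True
  have "(ln has_real_derivative 1 / x) (at x)"
    using True by (auto intro!: derivative_eq_intros)
  then show ?thesis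
    by (rule has_field_derivative_transform_within_open[where S = "{0<..}"]) (use True in auto)
next
  case False
  have "((\<lambda>x. ln (- x)) has_real_derivative 1 / x) (at x)"
    using False assms by (auto intro!: derivative_eq_intros)
  then show ?thesis
    by (rule has_field_derivative_transform_within_open[where S = "{..<0}"]) (use False assms in auto)
qed

text \<open>From ln t \<le> t - 1 at t = |w| and t = 1/|w|. It controls the logarithm for large
  arguments and near its singularity at once.\<close>

lemma abs_ln_abs_le:
  fixes w :: real
  assumes "w \<noteq> 0"
  shows "\<bar>ln \<bar>w\<bar>\<bar> \<le> \<bar>w\<bar> + 1 / \<bar>w\<bar>"
proof -
  have "ln \<bar>w\<bar> \<le> \<bar>w\<bar> - 1"
    using assms by (intro ln_le_minus_one) auto
  moreover have "ln (1 / \<bar>w\<bar>) \<le> 1 / \<bar>w\<bar> - 1"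
    using assms by (intro ln_le_minus_one) auto
  moreover have "ln (1 / \<bar>w\<bar>) = - ln \<bar>w\<bar>"
    using assms by (simp add: ln_div)
  moreover have "0 < \<bar>w\<bar>" "0 < 1 / \<bar>w\<bar>" using assms by auto
  ultimately show ?thesis by linarith
qed

text \<open>The cofactors k + y and k^2 + y^2 are at least 1, so the distance from \<open>y\<close>
  to \<open>k\<close> passes on to squares and fourth powers.\<close>

lemma abs_diff_powers_ge:
  fixes y d :: real
  assumes "y > 0" "k \<ge> 1" "0 < d" "d \<le> \<bar>real k - y\<bar>"
  shows "d \<le> \<bar>(real k)\<^sup>2 - y\<^sup>2\<bar>" "d \<le> \<bar>real k ^ 4 - y ^ 4\<bar>"
proof -
  have "d * 1 \<le> \<bar>real k - y\<bar> * (real k + y)"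
    using assms by (intro mult_mono) auto
  also have "\<dots> = \<bar>(real k - y) * (real k + y)\<bar>"
    using assms by (simp add: abs_mult)
  also have "(real k - y) * (real k + y) = (real k)\<^sup>2 - y\<^sup>2"
    by (simp add: power2_eq_square algebra_simps)
  finally show 1: "d \<le> \<bar>(real k)\<^sup>2 - y\<^sup>2\<bar>" by simp
  have "(real k)\<^sup>2 \<ge> 1\<^sup>2" using assms by (intro power_mono) auto
  then have "1 \<le> (real k)\<^sup>2 + y\<^sup>2"
    by (simp add: add_increasing2)
  then have "d * 1 \<le> \<bar>(real k)\<^sup>2 - y\<^sup>2\<bar> * ((real k)\<^sup>2 + y\<^sup>2)"
    using assms 1 by (intro mult_mono) auto
  also have "\<dots> = \<bar>((real k)\<^sup>2 - y\<^sup>2) * ((real k)\<^sup>2 + y\<^sup>2)\<bar>"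
    by (simp add: abs_mult)
  also have "((real k)\<^sup>2 - y\<^sup>2) * ((real k)\<^sup>2 + y\<^sup>2) = real k ^ 4 - y ^ 4"
    by (simp add: power2_eq_square power4_eq_xxxx algebra_simps)
  finally show "d \<le> \<bar>real k ^ 4 - y ^ 4\<bar>" by simp
qed

lemma abs_rational_term_le:
  assumes "y > 0" "k \<ge> 1" "0 < d" "d \<le> \<bar>real k - y\<bar>"
  shows "\<bar>rational_term y k\<bar> \<le> 2 / d * (real k ^ 1 * exp (- (1 * real k)))"
proof -
  note E = inverse_exp_minus_1_le[OF assms(2)]
  have "\<bar>rational_term y k\<bar> = 2 * real k * (1 / (exp (2 * pi * real k) - 1)) * (1 / \<bar>(real k)\<^sup>2 - y\<^sup>2\<bar>)"
    using E(1) by (simp add: rational_term_def abs_mult)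
  also have "\<dots> \<le> 2 * real k * exp (- real k) * (1 / d)"
    using E assms(3) abs_diff_powers_ge(1)[OF assms] by (intro mult_mono divide_left_mono) auto
  finally show ?thesis by simp
qed

lemma abs_log_term_le:
  assumes "y > 0" "k \<ge> 1" "0 < d" "d \<le> \<bar>real k - y\<bar>"
  shows "\<bar>log_term y k\<bar> \<le> 4 * (1 + y ^ 4 + 1 / d) * (real k ^ 4 * exp (- (1 * real k)))"
proof -
  note S = inverse_sinh_squared_le[OF assms(2)]
  note p = abs_diff_powers_ge(2)[OF assms]
  have "1 / \<bar>real k ^ 4 - y ^ 4\<bar> \<le> 1 / d"
    using p assms(3) by (intro divide_left_mono) auto
  moreover have "\<bar>real k ^ 4 - y ^ 4\<bar> \<le> real k ^ 4 + y ^ 4"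
    using assms(1) by (intro order_trans[OF abs_triangle_ineq4]) auto
  ultimately have "\<bar>ln \<bar>real k ^ 4 - y ^ 4\<bar>\<bar> \<le> real k ^ 4 + y ^ 4 + 1 / d"
    using abs_ln_abs_le[of "real k ^ 4 - y ^ 4"] p assms(3) by fastforce
  also have "\<dots> \<le> (1 + y ^ 4 + 1 / d) * real k ^ 4"
  proof -
    have "real k ^ 4 \<ge> 1 ^ 4" using assms by (intro power_mono) auto
    then have "(y ^ 4 + 1 / d) * 1 \<le> (y ^ 4 + 1 / d) * real k ^ 4"
      using assms by (intro mult_left_mono) auto
    then show ?thesis by (simp add: algebra_simps)
  qed
  finally have *: "\<bar>ln \<bar>real k ^ 4 - y ^ 4\<bar>\<bar> \<le> (1 + y ^ 4 + 1 / d) * real k ^ 4" .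
  have "\<bar>log_term y k\<bar> = \<bar>ln \<bar>real k ^ 4 - y ^ 4\<bar>\<bar> * (1 / (sinh (pi * real k))\<^sup>2)"
    by (simp add: log_term_def)
  also have "\<dots> \<le> (1 + y ^ 4 + 1 / d) * real k ^ 4 * (4 * exp (- real k))"
    using S assms by (intro mult_mono *) auto
  finally show ?thesis by (simp only: mult_1 mult_ac)
qed

lemma summable_rational_term:
  assumes "x \<notin> \<int>" "x > 0"
  shows "summable (\<lambda>k. rational_term x (Suc k))"
proof -
  obtain d where d: "0 < d" "\<And>n. d \<le> \<bar>real n - x\<bar>"
    using not_Int_neighbourhood[OF assms] by (metis less_imp_le)
  show ?thesis
  proof (rule summable_comparison_test'[where N = 0])
    show "summable (\<lambda>k. 2 / d * (real (Suc k) ^ 1 * exp (- (1 * real (Suc k)))))"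
      by (intro summable_power_times_exp) simp
    show "norm (rational_term x (Suc k)) \<le> 2 / d * (real (Suc k) ^ 1 * exp (- (1 * real (Suc k))))" for k
      unfolding real_norm_def using assms d by (intro abs_rational_term_le) (auto simp del: of_nat_Suc)
  qed
qed

lemma summable_log_term:
  assumes "x \<notin> \<int>" "x > 0"
  shows "summable (\<lambda>k. log_term x (Suc k))"
proof -
  obtain d where d: "0 < d" "\<And>n. d \<le> \<bar>real n - x\<bar>"
    using not_Int_neighbourhood[OF assms] by (metis less_imp_le)
  show ?thesis
  proof (rule summable_comparison_test'[where N = 0])
    show "summable (\<lambda>k. 4 * (1 + x ^ 4 + 1 / d) * (real (Suc k) ^ 4 * exp (- (1 * real (Suc k)))))"
      by (intro summable_power_times_exp) simp
    show "norm (log_term x (Suc k)) \<le> 4 * (1 + x ^ 4 + 1 / d) * (real (Suc k) ^ 4 * exp (- (1 * real (Suc k))))" for k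
      unfolding real_norm_def using assms d by (intro abs_log_term_le) (auto simp del: of_nat_Suc)
  qed
qed

lemma DERIV_suminf_rational_term:
  assumes x: "x \<notin> \<int>" "x > 0"
  defines "f' \<equiv> \<lambda>k y. 4 * real k * y / ((exp (2 * pi * real k) - 1) * ((real k)\<^sup>2 - y\<^sup>2)\<^sup>2)"
  shows "((\<lambda>x. \<Sum>k. rational_term x (Suc k)) has_real_derivative (\<Sum>k. f' (Suc k) x)) (at x)"
    and "summable (\<lambda>k. f' (Suc k) x)"
proof -
  from not_Int_neighbourhood[OF x] obtain a b d
    where ab: "0 < a" "a < x" "x < b" and d: "0 < d" "\<And>y n. a \<le> y \<Longrightarrow> y \<le> b \<Longrightarrow> d \<le> \<bar>real n - y\<bar>"
      and ni: "\<And>y. a \<le> y \<Longrightarrow> y \<le> b \<Longrightarrow> y \<notin> \<int>" by metis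
  have bound: "\<bar>f' k y\<bar> \<le> 4 * b / d\<^sup>2 * (real k ^ 1 * exp (- (1 * real k)))" if "a \<le> y" "y \<le> b" "k \<ge> 1" for k y
  proof -
    note E = inverse_exp_minus_1_le[OF that(3)]
    have "d \<le> \<bar>(real k)\<^sup>2 - y\<^sup>2\<bar>"
      using that ab d by (intro abs_diff_powers_ge) auto
    then have "d\<^sup>2 \<le> \<bar>(real k)\<^sup>2 - y\<^sup>2\<bar>\<^sup>2" using d by (intro power_mono) auto
    then have q: "d\<^sup>2 \<le> ((real k)\<^sup>2 - y\<^sup>2)\<^sup>2" by simp
    have "0 < d\<^sup>2" using d by simp
    have "\<bar>f' k y\<bar> = 4 * real k * y * (1 / (exp (2 * pi * real k) - 1)) * (1 / ((real k)\<^sup>2 - y\<^sup>2)\<^sup>2)"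
      using E(1) that ab by (simp add: f'_def abs_mult)
    also have "\<dots> \<le> 4 * real k * b * exp (- real k) * (1 / d\<^sup>2)"
      using E q \<open>0 < d\<^sup>2\<close> that ab by (intro mult_mono divide_left_mono mult_pos_pos mult_nonneg_nonneg) auto
    finally show ?thesis by (simp add: mult_ac)
  qed
  have der: "((\<lambda>x. 2 * c / (e * (c\<^sup>2 - x\<^sup>2))) has_real_derivative 4 * c * y / (e * (c\<^sup>2 - y\<^sup>2)\<^sup>2)) (at y)"
    if nz: "c\<^sup>2 - y\<^sup>2 \<noteq> 0" "e \<noteq> 0" for c e y :: real
  proof -
    define w where "w = c\<^sup>2 - y\<^sup>2"
    have "((\<lambda>x. e * (c\<^sup>2 - x\<^sup>2)) has_real_derivative e * (0 - 2 * y)) (at y)"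
      by (auto intro!: derivative_eq_intros)
    then have "((\<lambda>x. 2 * c / (e * (c\<^sup>2 - x\<^sup>2))) has_real_derivative
        (0 * (e * w) - 2 * c * (e * (0 - 2 * y))) / (e * w * (e * w))) (at y)"
      unfolding w_def using nz by (intro DERIV_divide DERIV_const) auto
    also have "(0 * (e * w) - 2 * c * (e * (0 - 2 * y))) / (e * w * (e * w)) = 4 * c * y / (e * w\<^sup>2)"
      using nz unfolding w_def[symmetric] by (simp add: field_simps power2_eq_square)
    finally show ?thesis unfolding w_def .
  qed
  have sM: "summable (\<lambda>k. 4 * b / d\<^sup>2 * (real (Suc k) ^ 1 * exp (- (1 * real (Suc k)))))"
    by (intro summable_power_times_exp) simp
  show "((\<lambda>x. \<Sum>k. rational_term x (Suc k)) has_real_derivative (\<Sum>k. f' (Suc k) x)) (at x)"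
  proof (rule DERIV_suminf_dominated[where a = a and b = b])
    fix k y assume y: "a \<le> y" "y \<le> b"
    have nz: "(real (Suc k))\<^sup>2 - y\<^sup>2 \<noteq> 0" by (rule real_not_Int_imp[OF ni[OF y]])
    have E: "exp (2 * pi * real (Suc k)) - 1 \<noteq> 0" using inverse_exp_minus_1_le(1)[of "Suc k"] by simp
    show "((\<lambda>x. rational_term x (Suc k)) has_real_derivative f' (Suc k) y) (at y)"
      unfolding rational_term_def f'_def by (rule der[OF nz E])
    show "\<bar>f' (Suc k) y\<bar> \<le> 4 * b / d\<^sup>2 * (real (Suc k) ^ 1 * exp (- (1 * real (Suc k))))"
      by (rule bound[OF y]) simp
  next
    show "summable (\<lambda>k. 4 * b / d\<^sup>2 * (real (Suc k) ^ 1 * exp (- (1 * real (Suc k)))))"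
      by (rule sM)
    show "summable (\<lambda>k. rational_term x (Suc k))"
      by (rule summable_rational_term[OF x])
  qed (use ab in auto)
  show "summable (\<lambda>k. f' (Suc k) x)"
    by (rule summable_comparison_test'[OF sM, of 0]) (use bound[of x "Suc _"] ab in \<open>simp del: of_nat_Suc\<close>)
qed

lemma DERIV_suminf_log_term:
  assumes x: "x \<notin> \<int>" "x > 0"
  defines "f' \<equiv> \<lambda>k y. - (4 * (y ^ 3 / ((real k ^ 4 - y ^ 4) * (sinh (pi * real k))\<^sup>2)))"
  shows "((\<lambda>x. \<Sum>k. log_term x (Suc k)) has_real_derivative (\<Sum>k. f' (Suc k) x)) (at x)"
    and "summable (\<lambda>k. f' (Suc k) x)"
proof -
  from not_Int_neighbourhood[OF x] obtain a b d
    where ab: "0 < a" "a < x" "x < b" and d: "0 < d" "\<And>y n. a \<le> y \<Longrightarrow> y \<le> b \<Longrightarrow> d \<le> \<bar>real n - y\<bar>"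
      and ni: "\<And>y. a \<le> y \<Longrightarrow> y \<le> b \<Longrightarrow> y \<notin> \<int>" by metis
  have bound: "\<bar>f' k y\<bar> \<le> 16 * b ^ 3 / d * (real k ^ 0 * exp (- (1 * real k)))" if "a \<le> y" "y \<le> b" "k \<ge> 1" for k y
  proof -
    note S = inverse_sinh_squared_le[OF that(3)]
    have q: "d \<le> \<bar>real k ^ 4 - y ^ 4\<bar>"
      using that ab d by (intro abs_diff_powers_ge) auto
    have "\<bar>f' k y\<bar> = 4 * y ^ 3 * (1 / \<bar>real k ^ 4 - y ^ 4\<bar>) * (1 / (sinh (pi * real k))\<^sup>2)"
      using that ab by (simp add: f'_def abs_mult)
    also have "\<dots> \<le> 4 * b ^ 3 * (1 / d) * (4 * exp (- real k))"
      using S q d that ab by (intro mult_mono divide_left_mono mult_pos_pos mult_nonneg_nonneg power_mono) auto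
    finally show ?thesis by (simp add: mult_ac)
  qed
  have sM: "summable (\<lambda>k. 16 * b ^ 3 / d * (real (Suc k) ^ 0 * exp (- (1 * real (Suc k)))))"
    by (intro summable_power_times_exp) simp
  show "((\<lambda>x. \<Sum>k. log_term x (Suc k)) has_real_derivative (\<Sum>k. f' (Suc k) x)) (at x)"
  proof (rule DERIV_suminf_dominated[where a = a and b = b])
    fix k y assume y: "a \<le> y" "y \<le> b"
    have nz: "real (Suc k) ^ 4 - y ^ 4 \<noteq> 0" by (rule real_not_Int_imp[OF ni[OF y]])
    have "((\<lambda>y. ln \<bar>real (Suc k) ^ 4 - y ^ 4\<bar>) has_real_derivative
        1 / (real (Suc k) ^ 4 - y ^ 4) * (- (4 * y ^ 3))) (at y)"
      by (rule DERIV_chain2[where f = "\<lambda>u. ln \<bar>u\<bar>" and g = "\<lambda>y. real (Suc k) ^ 4 - y ^ 4" and x = y, OF DERIV_ln_abs[OF nz]]) (auto intro!: derivative_eq_intros)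
    from DERIV_cdivide[OF this, of "(sinh (pi * real (Suc k)))\<^sup>2"]
    show "((\<lambda>x. log_term x (Suc k)) has_real_derivative f' (Suc k) y) (at y)"
      unfolding log_term_def f'_def by simp
    show "\<bar>f' (Suc k) y\<bar> \<le> 16 * b ^ 3 / d * (real (Suc k) ^ 0 * exp (- (1 * real (Suc k))))"
      by (rule bound[OF y]) simp
  next
    show "summable (\<lambda>k. 16 * b ^ 3 / d * (real (Suc k) ^ 0 * exp (- (1 * real (Suc k)))))"
      by (rule sM)
    show "summable (\<lambda>k. log_term x (Suc k))"
      by (rule summable_log_term[OF x])
  qed (use ab in auto)
  show "summable (\<lambda>k. f' (Suc k) x)"
    by (rule summable_comparison_test'[OF sM, of 0]) (use bound[of x "Suc _"] ab in \<open>simp del: of_nat_Suc\<close>)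
qed

text \<open>The series of k z^k has sum z/(1 - z)^2; here z = exp(-2 pi x).\<close>

lemma csch_squared_exp_sums:
  fixes x :: real
  assumes "x > 0"
  shows "(\<lambda>k. real (Suc k) * exp (- (2 * pi * x * real (Suc k)))) sums (1 / (4 * (sinh (pi * x))\<^sup>2))"
proof -
  define e where "e = exp (pi * x)"
  have e: "e > 1" using assms by (simp add: e_def)
  define z where "z = exp (- (2 * pi * x))"
  have z: "z = 1 / (e * e)"
    by (simp add: z_def e_def exp_minus inverse_eq_divide flip: exp_add)
  have "norm z < 1" using assms by (simp add: z_def)
  from sums_mult[OF geometric_deriv_sums[OF this], of z]
  have "(\<lambda>k. z * (real (Suc k) * z ^ k)) sums (z * (1 / (1 - z)\<^sup>2))" by simp
  also have "(\<lambda>k. z * (real (Suc k) * z ^ k)) = (\<lambda>k. real (Suc k) * exp (- (2 * pi * x * real (Suc k))))"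
  proof
    fix k
    have "exp (- (2 * pi * x * real (Suc k))) = z ^ Suc k"
      unfolding z_def by (subst exp_of_nat_mult[symmetric]) (simp add: mult_ac)
    then show "z * (real (Suc k) * z ^ k) = real (Suc k) * exp (- (2 * pi * x * real (Suc k)))"
      by simp
  qed
  also have "z * (1 / (1 - z)\<^sup>2) = 1 / (4 * (sinh (pi * x))\<^sup>2)"
  proof -
    have sinh_e: "4 * (sinh (pi * x))\<^sup>2 = (e - 1 / e)\<^sup>2"
      unfolding e_def by (rule four_sinh_squared)
    have "e * e > 1" using e by (metis less_1_mult)
    then show ?thesis
      using e unfolding z sinh_e by (simp add: field_simps power2_eq_square)
  qed
  finally show ?thesis .
qed

text \<open>The derivative is kept as a series because the same series appears in
  \<open>DERIV_suminf_trig_term\<close>, against which it cancels.\<close>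

lemma DERIV_csch_squared:
  fixes x :: real
  assumes x: "x > 0"
  shows "((\<lambda>x. 1 / (4 * (sinh (pi * x))\<^sup>2)) has_real_derivative
    - (2 * pi * (\<Sum>k. (real (Suc k))\<^sup>2 * exp (- (2 * pi * x * real (Suc k)))))) (at x)"
proof -
  have "((\<lambda>x. \<Sum>k. real (Suc k) * exp (- (2 * pi * x * real (Suc k)))) has_real_derivative
    (\<Sum>k. - (2 * pi * ((real (Suc k))\<^sup>2 * exp (- (2 * pi * x * real (Suc k))))))) (at x)"
  proof (rule DERIV_suminf_dominated[where a = "x / 2" and b = "2 * x"])
    fix k y assume y: "x / 2 \<le> y"
    show "((\<lambda>x. real (Suc k) * exp (- (2 * pi * x * real (Suc k)))) has_real_derivative
      - (2 * pi * ((real (Suc k))\<^sup>2 * exp (- (2 * pi * y * real (Suc k)))))) (at y)"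
      by (auto intro!: derivative_eq_intros simp: power2_eq_square simp del: of_nat_Suc)
    have "(real (Suc k))\<^sup>2 * exp (- (2 * pi * y * real (Suc k))) \<le>
        (real (Suc k))\<^sup>2 * exp (- (2 * pi * (x / 2) * real (Suc k)))"
      using y by (intro mult_left_mono) (auto intro!: mult_right_mono mult_left_mono simp del: of_nat_Suc)
    then have "2 * pi * ((real (Suc k))\<^sup>2 * exp (- (2 * pi * y * real (Suc k)))) \<le>
        2 * pi * ((real (Suc k))\<^sup>2 * exp (- (2 * pi * (x / 2) * real (Suc k))))"
      by (intro mult_left_mono) auto
    then show "\<bar>- (2 * pi * ((real (Suc k))\<^sup>2 * exp (- (2 * pi * y * real (Suc k)))))\<bar> \<le>
        2 * pi * ((real (Suc k))\<^sup>2 * exp (- (2 * pi * (x / 2) * real (Suc k))))"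
      by (simp add: abs_mult del: of_nat_Suc)
  next
    show "summable (\<lambda>k. 2 * pi * ((real (Suc k))\<^sup>2 * exp (- (2 * pi * (x / 2) * real (Suc k)))))"
      using x by (intro summable_power_times_exp) simp
  qed (use csch_squared_exp_sums[OF x] x in \<open>auto simp: sums_iff\<close>)
  moreover have "summable (\<lambda>k. 1 * ((real (Suc k))\<^sup>2 * exp (- (2 * pi * x * real (Suc k)))))"
    using x by (intro summable_power_times_exp) simp
  ultimately have "((\<lambda>x. \<Sum>k. real (Suc k) * exp (- (2 * pi * x * real (Suc k)))) has_real_derivative
    - (2 * pi * (\<Sum>k. (real (Suc k))\<^sup>2 * exp (- (2 * pi * x * real (Suc k)))))) (at x)"
    by (simp add: suminf_minus suminf_mult summable_mult del: of_nat_Suc)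
  then show ?thesis
    by (rule has_field_derivative_transform_within_open[where S = "{0<..}"])
       (use x csch_squared_exp_sums in \<open>auto simp: sums_iff\<close>)
qed

lemma DERIV_digamma_expansion:
  assumes x: "x \<notin> \<int>" "x > 0"
  shows "(digamma_expansion has_real_derivative Polygamma 1 (x + 1)) (at x)"
proof -
  define s E L q where "s = sin (pi * x)" and "E = exp (2 * pi * x)" and "L = ln \<bar>2 * sin (pi * x)\<bar>"
    and "q = (\<Sum>k. (real (Suc k))\<^sup>2 * exp (- (2 * pi * x * real (Suc k))))"
  have s: "s \<noteq> 0"
    using x by (metis mult.commute sin_times_pi_eq_0 s_def)
  have E: "E - 1 > 0" using x by (simp add: E_def)
  have sinh: "sinh (pi * x) \<noteq> 0" using x by simp
  \<comment> \<open>The left side comes from differentiating 1/(exp(2 pi x) - 1) in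
    \<open>d2\<close>, the right side is the factor of the logarithm in \<open>d3\<close>. Their
    equality cancels the two single cotangent terms.\<close>
  have E_sinh: "E / (E - 1)\<^sup>2 = 1 / (4 * (sinh (pi * x))\<^sup>2)"
  proof -
    define e where "e = exp (pi * x)"
    have e: "e > 1" using x by (simp add: e_def)
    then have "e * e > 1" by (metis less_1_mult)
    have "E = e * e" by (simp add: E_def e_def flip: exp_add)
    have sinh_e: "4 * (sinh (pi * x))\<^sup>2 = (e - 1 / e)\<^sup>2"
      unfolding e_def by (rule four_sinh_squared)
    show ?thesis
      using e \<open>e * e > 1\<close> unfolding \<open>E = e * e\<close> sinh_e by (simp add: field_simps power2_eq_square)
  qed
  have d1: "((\<lambda>x. pi / 3 * ln x + 1 / (2 * x) - 1 / (4 * pi * x\<^sup>2)) has_real_derivative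
      pi / (3 * x) - 1 / (2 * x\<^sup>2) + 1 / (2 * pi * x ^ 3)) (at x)"
    using x by (auto intro!: derivative_eq_intros simp: field_simps power2_eq_square power3_eq_cube)
  have d2: "((\<lambda>x. pi * cot (pi * x) / (exp (2 * pi * x) - 1)) has_real_derivative
      - (pi\<^sup>2 / (s\<^sup>2 * (E - 1))) - 2 * pi\<^sup>2 * cot (pi * x) * (E / (E - 1)\<^sup>2)) (at x)"
  proof -
    have "((\<lambda>x. cot (pi * x)) has_real_derivative - inverse ((sin (pi * x))\<^sup>2) * pi) (at x)"
      using s by (intro DERIV_cot[THEN DERIV_chain2]) (auto intro!: derivative_eq_intros simp: s_def)
    moreover have "((\<lambda>x. exp (2 * pi * x) - 1) has_real_derivative E * (2 * pi)) (at x)"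
      by (auto intro!: derivative_eq_intros simp: E_def)
    ultimately have "((\<lambda>x. pi * cot (pi * x) / (exp (2 * pi * x) - 1)) has_real_derivative
        (pi * (- inverse (s\<^sup>2) * pi) * (E - 1) - pi * cot (pi * x) * (E * (2 * pi))) / ((E - 1) * (E - 1))) (at x)"
      using E unfolding s_def E_def by (intro DERIV_divide DERIV_cmult) auto
    moreover have "(pi * (- inverse (s\<^sup>2) * pi) * (E - 1) - pi * c * (E * (2 * pi))) / ((E - 1) * (E - 1)) =
      - (pi\<^sup>2 / (s\<^sup>2 * (E - 1))) - 2 * pi\<^sup>2 * c * (E / (E - 1)\<^sup>2)" for c
    proof -
      have "(pi * (- inverse (s\<^sup>2) * pi) * w - pi * c * (E * (2 * pi))) / (w * w) =
        - (pi\<^sup>2 / (s\<^sup>2 * w)) - 2 * pi\<^sup>2 * c * (E / w\<^sup>2)" if "w \<noteq> 0" for w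
        using that s by (simp add: field_simps power2_eq_square)
      then show ?thesis using E by simp
    qed
    ultimately show ?thesis by simp
  qed
  have d3: "((\<lambda>x. pi * ln \<bar>2 * sin (pi * x)\<bar> / (2 * (sinh (pi * x))\<^sup>2)) has_real_derivative
      2 * pi\<^sup>2 * cot (pi * x) * (1 / (4 * (sinh (pi * x))\<^sup>2)) - 4 * pi\<^sup>2 * L * q) (at x)"
  proof -
    have "((\<lambda>x. ln \<bar>2 * sin (pi * x)\<bar>) has_real_derivative 1 / (2 * sin (pi * x)) * (2 * (cos (pi * x) * pi))) (at x)"
      by (rule DERIV_chain2[OF DERIV_ln_abs]) (use s in \<open>auto intro!: derivative_eq_intros simp: s_def\<close>)
    moreover have "1 / (2 * sin (pi * x)) * (2 * (cos (pi * x) * pi)) = pi * cot (pi * x)"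
      by (simp add: cot_def)
    ultimately have "((\<lambda>x. ln \<bar>2 * sin (pi * x)\<bar>) has_real_derivative pi * cot (pi * x)) (at x)" by simp
    \<comment> \<open>The logarithmic term is read as 2 pi L / (4 sinh^2(pi x)). Its part -4 pi^2 L
      q cancels against -2 pi times the derivative \<open>d6\<close>.\<close>
    from DERIV_cmult[OF DERIV_mult[OF this DERIV_csch_squared[OF x(2), folded q_def]], of "2 * pi"]
    show ?thesis
      by (simp add: L_def[symmetric] q_def[symmetric] algebra_simps power2_eq_square)
  qed
  note d4 = DERIV_suminf_rational_term[OF x]
  note d5 = DERIV_suminf_log_term[OF x]
  note d6 = DERIV_suminf_trig_term[OF x, folded L_def q_def]
  define R where "R = (\<Sum>k. 4 * real (Suc k) * x / ((exp (2 * pi * real (Suc k)) - 1) * ((real (Suc k))\<^sup>2 - x\<^sup>2)\<^sup>2))"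
  define G where "G = (\<Sum>k. - (4 * (x ^ 3 / ((real (Suc k) ^ 4 - x ^ 4) * (sinh (pi * real (Suc k)))\<^sup>2))))"
  have "(digamma_expansion has_real_derivative
     (pi / (3 * x) - 1 / (2 * x\<^sup>2) + 1 / (2 * pi * x ^ 3))
     + (- (pi\<^sup>2 / (s\<^sup>2 * (E - 1))) - 2 * pi\<^sup>2 * cot (pi * x) * (E / (E - 1)\<^sup>2))
     + (2 * pi\<^sup>2 * cot (pi * x) * (1 / (4 * (sinh (pi * x))\<^sup>2)) - 4 * pi\<^sup>2 * L * q)
     + R - pi / 2 * G - 2 * pi * (- (2 * pi * L * q))) (at x)"
    unfolding digamma_expansion_def[abs_def] R_def G_def
    by (intro DERIV_add DERIV_diff DERIV_cmult d1 d2 d3 d4(1) d5(1) d6)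
  moreover have "R + - pi / 2 * G = Polygamma 1 (x + 1) + pi\<^sup>2 / (s\<^sup>2 * (E - 1))
      - 1 / (2 * pi * x ^ 3) - pi / (3 * x) + 1 / (2 * x\<^sup>2)"
  proof -
    have "(\<lambda>k. 4 * real (Suc k) * x / ((exp (2 * pi * real (Suc k)) - 1) * ((real (Suc k))\<^sup>2 - x\<^sup>2)\<^sup>2)
        + - pi / 2 * - (4 * (x ^ 3 / ((real (Suc k) ^ 4 - x ^ 4) * (sinh (pi * real (Suc k)))\<^sup>2)))) sums
      (R + - pi / 2 * G)"
      unfolding R_def G_def by (intro sums_add sums_mult summable_sums d4(2) d5(2))
    also have "(\<lambda>k. 4 * real (Suc k) * x / ((exp (2 * pi * real (Suc k)) - 1) * ((real (Suc k))\<^sup>2 - x\<^sup>2)\<^sup>2)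
        + - pi / 2 * - (4 * (x ^ 3 / ((real (Suc k) ^ 4 - x ^ 4) * (sinh (pi * real (Suc k)))\<^sup>2)))) =
       (\<lambda>k. 4 * real (Suc k) * x / ((exp (2 * pi * real (Suc k)) - 1) * ((real (Suc k))\<^sup>2 - x\<^sup>2)\<^sup>2)
      + 2 * pi * (x ^ 3 / ((real (Suc k) ^ 4 - x ^ 4) * (sinh (pi * real (Suc k)))\<^sup>2)))"
      by (simp add: mult.assoc del: of_nat_Suc)
    finally show ?thesis
      unfolding s_def E_def by (rule sums_unique2) (rule Polygamma_1_plus1_sums[OF x(2,1)])
  qed
  ultimately show ?thesis
    unfolding E_sinh by (simp add: algebra_simps power2_eq_square)
qed

section \<open>Behaviour at the integers\<close>

lemma tendsto_at_offset_0:
  fixes f :: "real \<Rightarrow> real"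
  assumes "((\<lambda>t. f (a + t)) \<longlongrightarrow> l) (at 0)"
  shows "(f \<longlongrightarrow> l) (at a)"
  using assms by (simp add: at_to_0[of a] filterlim_filtermap add.commute)

lemma ex_tendsto_cong:
  assumes "(f \<longlongrightarrow> l) F" "\<forall>\<^sub>F x in F. f x = g x"
  shows "\<exists>l. (g \<longlongrightarrow> l) F"
  using Lim_transform_eventually[OF assms] by blast

lemma abs_sin_pi_add_nat: "\<bar>sin (pi * (real m + t))\<bar> = \<bar>sin (pi * t)\<bar>"
  by (simp add: distrib_left sin_add abs_mult)

lemma cot_pi_add_nat: "cot (pi * (real m + t)) = cot (pi * t)"
  by (simp add: distrib_left cot_def sin_add cos_add)

text \<open>With E(x) = 1/(exp(2 pi x) - 1), the singular parts are E(x)/(x - a) from the cotangent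
  and -E(a)/(x - a) from the rational term. Together they form a difference quotient of E, which
  converges.\<close>

lemma cot_rational_term_limit:
  assumes m: "m \<ge> 1"
  shows "\<exists>l. ((\<lambda>x. pi * cot (pi * x) / (exp (2 * pi * x) - 1) + rational_term x m) \<longlongrightarrow> l) (at (real m))"
proof -
  define a where "a = real m"
  have a: "a > 0" using m by (simp add: a_def)
  define E where "E x = 1 / (exp (2 * pi * x) - 1)" for x :: real
  have "((\<lambda>x. exp (2 * pi * x) - 1) has_real_derivative exp (2 * pi * a) * (2 * pi)) (at a)"
    by (auto intro!: derivative_eq_intros)
  from DERIV_divide[OF DERIV_const[of 1] this]
  obtain E' where E': "(E has_real_derivative E') (at a)"
    unfolding E_def[abs_def] using a by auto
  then have quot: "((\<lambda>x. (E x - E a) / (x - a)) \<longlongrightarrow> E') (at a)"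
    by (simp add: has_field_derivative_iff)
  have Ec: "(E \<longlongrightarrow> E a) (at a)"
    using DERIV_isCont[OF E'] by (simp add: isCont_def)
  have "((\<lambda>t. pi * cot (pi * t) - 1 / t) \<longlongrightarrow> 0) (at 0)"
    unfolding cot_def by real_asymp
  then have cot: "((\<lambda>x. pi * cot (pi * x) - 1 / (x - a)) \<longlongrightarrow> 0) (at a)"
    by - (rule tendsto_at_offset_0, simp add: a_def cot_pi_add_nat)
  have "((\<lambda>x. (pi * cot (pi * x) - 1 / (x - a)) * E x + (E x - E a) / (x - a) + E a / (a + x)) \<longlongrightarrow>
      0 * E a + E' + E a / (a + a)) (at a)"
    using a by (intro tendsto_intros cot quot Ec) auto
  moreover have "\<forall>\<^sub>F x in at a. (pi * cot (pi * x) - 1 / (x - a)) * E x + (E x - E a) / (x - a) + E a / (a + x) =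
      pi * cot (pi * x) / (exp (2 * pi * x) - 1) + rational_term x m"
  proof -
    have "\<forall>\<^sub>F x in at a. x > 0" using a by (intro order_tendstoD[OF tendsto_ident_at]) auto
    moreover have "\<forall>\<^sub>F x in at a. x \<noteq> a" by (simp add: eventually_at_filter)
    ultimately show ?thesis
    proof eventually_elim
      case (elim x)
      have "rational_term x m = E a * (2 * a / (a\<^sup>2 - x\<^sup>2))"
        by (simp add: rational_term_def E_def a_def)
      also have "a\<^sup>2 - x\<^sup>2 = (a - x) * (a + x)" by (simp add: power2_eq_square algebra_simps)
      also have "2 * a / ((a - x) * (a + x)) = 1 / (a + x) - 1 / (x - a)"
        using elim a by (simp add: divide_simps) (simp add: algebra_simps)
      finally have R: "rational_term x m = E a * (1 / (a + x) - 1 / (x - a))" .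
      have C: "pi * cot (pi * x) / (exp (2 * pi * x) - 1) = pi * cot (pi * x) * E x"
        by (simp add: E_def)
      show ?case unfolding R C by (simp add: algebra_simps diff_divide_distrib)
    qed
  qed
  ultimately show ?thesis
    unfolding a_def by (rule ex_tendsto_cong)
qed

text \<open>Both summands contain ln |x - a|, with weights q(x) and q(a) for q = 1/sinh^2(pi x), up
  to the common factor pi/2. The difference is the difference quotient of q times (x - a) ln |x -
  a|, and the latter tends to 0.\<close>

lemma ln_sin_log_term_limit:
  assumes m: "m \<ge> 1"
  shows "\<exists>l. ((\<lambda>x. pi * ln \<bar>2 * sin (pi * x)\<bar> / (2 * (sinh (pi * x))\<^sup>2) - pi / 2 * log_term x m) \<longlongrightarrow> l) (at (real m))"
proof -
  define a where "a = real m"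
  have a: "a > 0" using m by (simp add: a_def)
  define q where "q x = 1 / (sinh (pi * x))\<^sup>2" for x :: real
  have "((\<lambda>x. 4 * (1 / (4 * (sinh (pi * x))\<^sup>2))) has_real_derivative
      4 * - (2 * pi * (\<Sum>k. (real (Suc k))\<^sup>2 * exp (- (2 * pi * a * real (Suc k)))))) (at a)"
    by (rule DERIV_cmult[OF DERIV_csch_squared[OF a]])
  then obtain q' where q': "(q has_real_derivative q') (at a)"
    unfolding q_def[abs_def] by (simp del: of_nat_Suc)
  then have quot: "((\<lambda>x. (q x - q a) / (x - a)) \<longlongrightarrow> q') (at a)"
    by (simp add: has_field_derivative_iff)
  have qc: "(q \<longlongrightarrow> q a) (at a)"
    using DERIV_isCont[OF q'] by (simp add: isCont_def)
  define g where "g x = ln ((x + a) * (x\<^sup>2 + a\<^sup>2))" for x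
  have gc: "(g \<longlongrightarrow> g a) (at a)"
    unfolding g_def using a by (intro tendsto_intros) (auto simp: add_pos_pos)
  have "((\<lambda>t. 2 * sin (pi * t) / t) \<longlongrightarrow> 2 * pi) (at 0)"
    by real_asymp
  then have "((\<lambda>t. ln \<bar>2 * sin (pi * t) / t\<bar>) \<longlongrightarrow> ln \<bar>2 * pi\<bar>) (at 0)"
    by (intro tendsto_ln tendsto_rabs) auto
  then have sin: "((\<lambda>x. ln \<bar>2 * sin (pi * x) / (x - a)\<bar>) \<longlongrightarrow> ln \<bar>2 * pi\<bar>) (at a)"
    by - (rule tendsto_at_offset_0, (simp add: a_def abs_mult abs_sin_pi_add_nat))
  have "((\<lambda>t. t * ln \<bar>t\<bar>) \<longlongrightarrow> 0) (at (0::real))"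
    by real_asymp
  then have xln: "((\<lambda>x. (x - a) * ln \<bar>x - a\<bar>) \<longlongrightarrow> 0) (at a)"
    by - (rule tendsto_at_offset_0, simp)
  have "((\<lambda>x. pi / 2 * ((ln \<bar>2 * sin (pi * x) / (x - a)\<bar> - g x) * q x
      + ((x - a) * ln \<bar>x - a\<bar> + (x - a) * g x) * ((q x - q a) / (x - a)))) \<longlongrightarrow>
    pi / 2 * ((ln \<bar>2 * pi\<bar> - g a) * q a + (0 + (a - a) * g a) * q')) (at a)"
    by (intro tendsto_intros sin gc qc quot xln)
  moreover have "\<forall>\<^sub>F x in at a. pi / 2 * ((ln \<bar>2 * sin (pi * x) / (x - a)\<bar> - g x) * q x
      + ((x - a) * ln \<bar>x - a\<bar> + (x - a) * g x) * ((q x - q a) / (x - a))) =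
    pi * ln \<bar>2 * sin (pi * x)\<bar> / (2 * (sinh (pi * x))\<^sup>2) - pi / 2 * log_term x m"
  proof -
    have "\<forall>\<^sub>F x in at a. x > 0" using a by (intro order_tendstoD[OF tendsto_ident_at]) auto
    moreover have "\<forall>\<^sub>F x in at a. x \<noteq> a" by (simp add: eventually_at_filter)
    moreover have "\<forall>\<^sub>F x in at a. 0 < \<bar>2 * sin (pi * x) / (x - a)\<bar>"
    proof -
      \<comment> \<open>The limit ln(2 pi) is positive, and \<open>ln 0 = 0\<close>, so a positive
        logarithm shows that the quotient is nonzero near \<open>a\<close>.\<close>
      have "\<forall>\<^sub>F x in at a. ln \<bar>2 * sin (pi * x) / (x - a)\<bar> > 0"
        using pi_gt3 by (intro order_tendstoD[OF sin]) auto
      then show ?thesis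
      proof eventually_elim
        case (elim x)
        then have "\<bar>2 * sin (pi * x) / (x - a)\<bar> \<noteq> 0"
          by (metis ln_0 less_irrefl)
        then show ?case
          by (simp only: zero_less_abs_iff abs_eq_0 not_False_eq_True)
      qed
    qed
    ultimately show ?thesis
    proof eventually_elim
      case (elim x)
      have s: "ln \<bar>2 * sin (pi * x)\<bar> = ln \<bar>2 * sin (pi * x) / (x - a)\<bar> + ln \<bar>x - a\<bar>"
        using elim by (subst ln_mult_pos[symmetric]) auto
      have pos: "x + a > 0" "x\<^sup>2 + a\<^sup>2 > 0" using elim a by (auto intro: add_pos_pos)
      have "a ^ 4 - x ^ 4 = - ((x - a) * ((x + a) * (x\<^sup>2 + a\<^sup>2)))"
        by (simp add: power2_eq_square power4_eq_xxxx algebra_simps)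
      then have "\<bar>a ^ 4 - x ^ 4\<bar> = \<bar>x - a\<bar> * ((x + a) * (x\<^sup>2 + a\<^sup>2))"
        using pos by (simp add: abs_mult)
      then have "ln \<bar>a ^ 4 - x ^ 4\<bar> = ln \<bar>x - a\<bar> + g x"
        unfolding g_def using pos elim by (simp only:) (rule ln_mult_pos, auto)
      then have l: "log_term x m = (ln \<bar>x - a\<bar> + g x) * q a"
        by (simp add: log_term_def a_def q_def)
      have c: "pi * ln \<bar>2 * sin (pi * x)\<bar> / (2 * (sinh (pi * x))\<^sup>2) = pi / 2 * (ln \<bar>2 * sin (pi * x)\<bar> * q x)"
        by (simp add: q_def)
      have "((x - a) * ln \<bar>x - a\<bar> + (x - a) * g x) * ((q x - q a) / (x - a)) = (ln \<bar>x - a\<bar> + g x) * (q x - q a)"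
        using elim by (simp add: field_simps)
      then show ?case
        unfolding c l unfolding s by (simp only:) (simp add: algebra_simps)
    qed
  qed
  ultimately show ?thesis
    unfolding a_def by (rule ex_tendsto_cong)
qed

lemma suminf_remove_term:
  fixes f :: "nat \<Rightarrow> real"
  assumes "summable f"
  shows "(\<Sum>k. f k) = f j + (\<Sum>k. if k = j then 0 else f k)"
proof -
  have "(\<lambda>k. if k = j then f j else 0) sums f j"
    using sums_single[of j f] by (rule sums_cong[THEN iffD1, rotated]) auto
  then have "(\<lambda>k. f k - (if k = j then f j else 0)) sums ((\<Sum>k. f k) - f j)"
    by (intro sums_diff summable_sums assms)
  moreover have "(\<lambda>k. f k - (if k = j then f j else 0)) = (\<lambda>k. if k = j then 0 else f k)"
    by auto
  ultimately show ?thesis by (simp add: sums_iff)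
qed

lemma half_le_abs_diff:
  assumes "\<bar>x - real m\<bar> < 1 / 2" "k \<noteq> m"
  shows "1 / 2 \<le> \<bar>real k - x\<bar>"
proof -
  have "\<bar>real k - real m\<bar> \<ge> 1"
    using assms(2) by (cases "k < m") auto
  then show ?thesis using assms(1) by linarith
qed

text \<open>The terms with index \<open>m\<close> are taken out of the two singular series and
  paired with the cotangent and the logarithm. The remaining series are dominated near
  \<open>m\<close>.\<close>

lemma digamma_expansion_limit_at_nat:
  assumes m: "m \<ge> 1"
  shows "\<exists>l. (digamma_expansion \<longlongrightarrow> l) (at (real m))"
proof -
  define a where "a = real m"
  have a: "a \<ge> 1" using m by (simp add: a_def)
  define R where "R x = (\<Sum>k. if Suc k = m then 0 else rational_term x (Suc k))" for x
  define G where "G x = (\<Sum>k. if Suc k = m then 0 else log_term x (Suc k))" for x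
  \<comment> \<open>Radius 1/2 keeps \<open>x\<close> positive, non-integral, and at distance at
    least 1/2 from every natural number other than \<open>m\<close>.\<close>
  have near: "\<forall>\<^sub>F x in at a. \<bar>x - a\<bar> < 1 / 2 \<and> x \<noteq> a"
    unfolding eventually_at by (rule exI[of _ "1 / 2"]) (auto simp: dist_real_def)
  have R: "(R \<longlongrightarrow> R a) (at a)"
    unfolding R_def
  proof (rule tendsto_suminf_dominated)
    show "summable (\<lambda>k. 2 / (1 / 2) * (real (Suc k) ^ 1 * exp (- (1 * real (Suc k)))))"
      by (intro summable_power_times_exp) simp
    show "((\<lambda>x. if Suc k = m then 0 else rational_term x (Suc k)) \<longlongrightarrow>
        (if Suc k = m then 0 else rational_term a (Suc k))) (at a)" for k
    proof (cases "Suc k = m")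
      case False
      have "real (Suc k) \<noteq> a" using False unfolding a_def by (metis of_nat_eq_iff)
      then have "(real (Suc k))\<^sup>2 \<noteq> a\<^sup>2" using a by (simp add: power2_eq_iff del: of_nat_Suc)
      moreover have "exp (2 * pi * real (Suc k)) - 1 \<noteq> 0"
        using inverse_exp_minus_1_le(1)[of "Suc k"] by simp
      ultimately show ?thesis
        unfolding rational_term_def by (simp only: False if_False) (intro tendsto_intros, simp)
    qed simp
    show "\<forall>\<^sub>F x in at a. \<forall>k. \<bar>if Suc k = m then 0 else rational_term x (Suc k)\<bar> \<le>
        2 / (1 / 2) * (real (Suc k) ^ 1 * exp (- (1 * real (Suc k))))"
      using near
    proof eventually_elim
      case (elim x)
      have "x > 0" using elim a by linarith
      have "\<bar>rational_term x (Suc k)\<bar> \<le> 2 / (1 / 2) * (real (Suc k) ^ 1 * exp (- (1 * real (Suc k))))" if "Suc k \<noteq> m" for k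
        using elim \<open>x > 0\<close> half_le_abs_diff[OF _ that, of x] by (intro abs_rational_term_le) (auto simp: a_def simp del: of_nat_Suc)
      then show ?case by auto
    qed
  qed auto
  have G: "(G \<longlongrightarrow> G a) (at a)"
    unfolding G_def
  proof (rule tendsto_suminf_dominated)
    show "summable (\<lambda>k. 4 * (1 + (a + 1) ^ 4 + 1 / (1 / 2)) * (real (Suc k) ^ 4 * exp (- (1 * real (Suc k)))))"
      by (intro summable_power_times_exp) simp
    show "((\<lambda>x. if Suc k = m then 0 else log_term x (Suc k)) \<longlongrightarrow>
        (if Suc k = m then 0 else log_term a (Suc k))) (at a)" for k
    proof (cases "Suc k = m")
      case False
      then have "1 / 2 \<le> \<bar>real (Suc k) - a\<bar>" unfolding a_def by (intro half_le_abs_diff) auto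
      then have "1 / 2 \<le> \<bar>real (Suc k) ^ 4 - a ^ 4\<bar>"
        using a by (intro abs_diff_powers_ge) auto
      then have "\<bar>real (Suc k) ^ 4 - a ^ 4\<bar> > 0" by linarith
      then show ?thesis
        unfolding log_term_def by (simp only: False if_False) (intro tendsto_intros, auto)
    qed simp
    show "\<forall>\<^sub>F x in at a. \<forall>k. \<bar>if Suc k = m then 0 else log_term x (Suc k)\<bar> \<le>
        4 * (1 + (a + 1) ^ 4 + 1 / (1 / 2)) * (real (Suc k) ^ 4 * exp (- (1 * real (Suc k))))"
      using near
    proof eventually_elim
      case (elim x)
      have "x > 0" using elim a by linarith
      have "\<bar>log_term x (Suc k)\<bar> \<le> 4 * (1 + (a + 1) ^ 4 + 1 / (1 / 2)) * (real (Suc k) ^ 4 * exp (- (1 * real (Suc k))))"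
        if "Suc k \<noteq> m" for k
      proof -
        have "\<bar>log_term x (Suc k)\<bar> \<le> 4 * (1 + x ^ 4 + 1 / (1 / 2)) * (real (Suc k) ^ 4 * exp (- (1 * real (Suc k))))"
          using elim \<open>x > 0\<close> half_le_abs_diff[OF _ that, of x] by (intro abs_log_term_le) (auto simp: a_def simp del: of_nat_Suc)
        also have "x ^ 4 \<le> (a + 1) ^ 4"
        proof (rule power_mono)
          show "x \<le> a + 1" "0 \<le> x" using elim a by linarith+
        qed
        finally show ?thesis by (simp add: mult_right_mono)
      qed
      then show ?case using a by auto
    qed
  qed auto
  have T: "((\<lambda>x. \<Sum>k. trig_term x (Suc k)) \<longlongrightarrow> (\<Sum>k. trig_term a (Suc k))) (at a)"
    using isCont_suminf_trig_term[of a] a by (simp add: isCont_def)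
  obtain l1 where l1: "((\<lambda>x. pi * cot (pi * x) / (exp (2 * pi * x) - 1) + rational_term x m) \<longlongrightarrow> l1) (at a)"
    using cot_rational_term_limit[OF m] by (auto simp: a_def)
  obtain l2 where l2: "((\<lambda>x. pi * ln \<bar>2 * sin (pi * x)\<bar> / (2 * (sinh (pi * x))\<^sup>2) - pi / 2 * log_term x m) \<longlongrightarrow> l2) (at a)"
    using ln_sin_log_term_limit[OF m] by (auto simp: a_def)
  have "((\<lambda>x. (pi / 3 * ln x + 1 / (2 * x) - 1 / (4 * pi * x\<^sup>2))
      + (pi * cot (pi * x) / (exp (2 * pi * x) - 1) + rational_term x m)
      + (pi * ln \<bar>2 * sin (pi * x)\<bar> / (2 * (sinh (pi * x))\<^sup>2) - pi / 2 * log_term x m)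
      + R x - pi / 2 * G x - 2 * pi * (\<Sum>k. trig_term x (Suc k))) \<longlongrightarrow>
    (pi / 3 * ln a + 1 / (2 * a) - 1 / (4 * pi * a\<^sup>2)) + l1 + l2
      + R a - pi / 2 * G a - 2 * pi * (\<Sum>k. trig_term a (Suc k))) (at a)"
    using a by (intro tendsto_add tendsto_diff tendsto_mult l1 l2 R G T tendsto_intros) auto
  moreover have "\<forall>\<^sub>F x in at a. (pi / 3 * ln x + 1 / (2 * x) - 1 / (4 * pi * x\<^sup>2))
      + (pi * cot (pi * x) / (exp (2 * pi * x) - 1) + rational_term x m)
      + (pi * ln \<bar>2 * sin (pi * x)\<bar> / (2 * (sinh (pi * x))\<^sup>2) - pi / 2 * log_term x m)
      + R x - pi / 2 * G x - 2 * pi * (\<Sum>k. trig_term x (Suc k)) = digamma_expansion x"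
    using near
  proof eventually_elim
    case (elim x)
    have x: "x > 0" using elim a by linarith
    have "x \<notin> \<int>"
    proof
      assume "x \<in> \<int>"
      then obtain j where "x = of_int j" by (auto elim: Ints_cases)
      then have "\<bar>of_int (j - int m)\<bar> < (1 / 2 :: real)" "j \<noteq> int m" using elim by (auto simp: a_def)
      then show False by linarith
    qed
    obtain j where j: "m = Suc j" using m by (cases m) auto
    have 1: "(\<Sum>k. rational_term x (Suc k)) = rational_term x m + R x"
      unfolding R_def j using suminf_remove_term[OF summable_rational_term[OF \<open>x \<notin> \<int>\<close> x], of j] by simp
    have 2: "(\<Sum>k. log_term x (Suc k)) = log_term x m + G x"
      unfolding G_def j using suminf_remove_term[OF summable_log_term[OF \<open>x \<notin> \<int>\<close> x], of j] by simp
    show ?case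
      unfolding digamma_expansion_def 1 2 by (simp add: algebra_simps)
  qed
  ultimately show ?thesis
    unfolding a_def by (rule ex_tendsto_cong)
qed

section \<open>Behaviour at infinity\<close>

text \<open>By monotonicity the value lies between \<open>Digamma\<close> at n + 1 and at n + 2,
  which are harmonic numbers minus Euler's constant.\<close>

lemma Digamma_half_minus_ln_tendsto:
  "(\<lambda>n. Digamma (real n + 1 / 2 + 1) - ln (real n + 1 / 2)) \<longlonglongrightarrow> 0"
proof (rule tendsto_sandwich)
  have lim: "(\<lambda>n. harm n - ln (real n) :: real) \<longlonglongrightarrow> euler_mascheroni"
    by (rule euler_mascheroni_LIMSEQ)
  have "(\<lambda>n. ln (real n) - ln (real n + 1 / 2)) \<longlonglongrightarrow> 0"
    by real_asymp
  from tendsto_diff[OF tendsto_add[OF lim this] tendsto_const[of euler_mascheroni]]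
  show 1: "(\<lambda>n. (harm n - ln (real n)) + (ln (real n) - ln (real n + 1 / 2)) - euler_mascheroni) \<longlonglongrightarrow> (0::real)"
    by simp
  have "(\<lambda>n. 1 / real (Suc n)) \<longlonglongrightarrow> 0" by real_asymp
  from tendsto_add[OF 1 this]
  show "(\<lambda>n. (harm n - ln (real n)) + (ln (real n) - ln (real n + 1 / 2)) - euler_mascheroni + 1 / real (Suc n)) \<longlonglongrightarrow> (0::real)"
    by simp
  have D: "Digamma (real (Suc n)) = harm n - euler_mascheroni" for n
    by (rule Digamma_of_nat)
  have "Digamma (real (Suc n)) \<le> Digamma (real n + 1 / 2 + 1)" for n
    by (rule Digamma_real_mono) auto
  then have lower: "harm n - euler_mascheroni \<le> Digamma (real n + 1 / 2 + 1)" for n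
    unfolding D .
  show "\<forall>\<^sub>F n in sequentially. (harm n - ln (real n)) + (ln (real n) - ln (real n + 1 / 2)) - euler_mascheroni
      \<le> Digamma (real n + 1 / 2 + 1) - ln (real n + 1 / 2)"
    using lower by (intro always_eventually allI) (simp add: algebra_simps)
  have "Digamma (real n + 1 / 2 + 1) \<le> Digamma (real (Suc (Suc n)))" for n
    by (rule Digamma_real_mono) auto
  then have "Digamma (real n + 1 / 2 + 1) \<le> harm n + 1 / real (Suc n) - euler_mascheroni" for n
    unfolding D by (simp add: harm_Suc inverse_eq_divide)
  then show "\<forall>\<^sub>F n in sequentially. Digamma (real n + 1 / 2 + 1) - ln (real n + 1 / 2) \<le>
      (harm n - ln (real n)) + (ln (real n) - ln (real n + 1 / 2)) - euler_mascheroni + 1 / real (Suc n)"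
    by (intro always_eventually allI) (simp add: algebra_simps)
qed

lemma half_integer_dist: "1 / 2 \<le> \<bar>real k - (real n + 1 / 2)\<bar>"
  by (cases "k \<le> n") (auto simp: abs_if)

lemma half_integer_not_Int: "real n + 1 / 2 \<notin> \<int>"
proof
  assume "real n + 1 / 2 \<in> \<int>"
  then obtain j where "real n + 1 / 2 = of_int j" by (auto elim: Ints_cases)
  then have "of_int (2 * j - 2 * int n) = (of_int 1 :: real)" by simp
  then have "2 * j - 2 * int n = 1" by (simp only: of_int_eq_iff)
  then show False by presburger
qed

text \<open>Subtracting 4 ln x turns each logarithm into ln |k^4/x^4 - 1|, which tends to ln 1 = 0
  for fixed k. A majorant uniform in \<open>n\<close> exists because half-integers stay away from
  the singularities.\<close>

lemma log_quotient_sum_tendsto_0: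
  "(\<lambda>n. \<Sum>k. (ln \<bar>real (Suc k) ^ 4 - (real n + 1 / 2) ^ 4\<bar> - 4 * ln (real n + 1 / 2)) / (sinh (pi * real (Suc k)))\<^sup>2) \<longlonglongrightarrow> 0"
proof -
  have quot: "ln \<bar>real k ^ 4 - (real n + 1 / 2) ^ 4\<bar> - 4 * ln (real n + 1 / 2) =
      ln \<bar>(real k ^ 4 - (real n + 1 / 2) ^ 4) / (real n + 1 / 2) ^ 4\<bar>" if "k \<ge> 1" for k n
  proof -
    define x where "x = real n + 1 / 2"
    have x: "x > 0" by (simp add: x_def)
    have "1 / 2 \<le> \<bar>real k ^ 4 - x ^ 4\<bar>"
      using x that half_integer_dist[of k n] by (intro abs_diff_powers_ge) (auto simp: x_def)
    then have "\<bar>real k ^ 4 - x ^ 4\<bar> > 0" by linarith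
    then show ?thesis
      using x unfolding x_def[symmetric] by (simp add: ln_div ln_realpow)
  qed
  have "(\<lambda>n. \<Sum>k. (ln \<bar>real (Suc k) ^ 4 - (real n + 1 / 2) ^ 4\<bar> - 4 * ln (real n + 1 / 2)) / (sinh (pi * real (Suc k)))\<^sup>2)
      \<longlonglongrightarrow> (\<Sum>k. 0)"
  proof (rule tendsto_suminf_dominated)
    show "summable (\<lambda>k. 20 * (real (Suc k) ^ 4 * exp (- (1 * real (Suc k)))))"
      by (intro summable_power_times_exp) simp
    show "(\<lambda>n. (ln \<bar>real (Suc k) ^ 4 - (real n + 1 / 2) ^ 4\<bar> - 4 * ln (real n + 1 / 2)) / (sinh (pi * real (Suc k)))\<^sup>2) \<longlonglongrightarrow> 0" for k
    proof -
      have "(\<lambda>n. (c - (real n + 1 / 2) ^ 4) / (real n + 1 / 2) ^ 4) \<longlonglongrightarrow> - 1" for c :: real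
        by real_asymp
      then have "(\<lambda>n. ln \<bar>(real (Suc k) ^ 4 - (real n + 1 / 2) ^ 4) / (real n + 1 / 2) ^ 4\<bar>) \<longlonglongrightarrow> ln \<bar>- 1\<bar>"
        by (intro tendsto_ln tendsto_rabs) auto
      then have "(\<lambda>n. ln \<bar>real (Suc k) ^ 4 - (real n + 1 / 2) ^ 4\<bar> - 4 * ln (real n + 1 / 2)) \<longlonglongrightarrow> 0"
        by (subst quot) auto
      then show ?thesis
        by (rule tendsto_divide_zero)
    qed
    show "\<forall>\<^sub>F n in sequentially. \<forall>k. \<bar>(ln \<bar>real (Suc k) ^ 4 - (real n + 1 / 2) ^ 4\<bar> - 4 * ln (real n + 1 / 2)) / (sinh (pi * real (Suc k)))\<^sup>2\<bar>
        \<le> 20 * (real (Suc k) ^ 4 * exp (- (1 * real (Suc k))))"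
    proof (rule eventually_mono[OF eventually_ge_at_top[of "1::nat"]], intro allI)
      fix n k :: nat assume n: "1 \<le> n"
      define x N where "x = real n + 1 / 2" and "N = real (Suc k)"
      have x: "x > 1" "x ^ 4 > 1" using n by (auto simp: x_def)
      have N: "N ^ 4 \<ge> 1" by (simp add: N_def)
      have d: "1 / 2 \<le> \<bar>N ^ 4 - x ^ 4\<bar>"
        unfolding N_def using x half_integer_dist[of "Suc k" n]
        by (intro abs_diff_powers_ge) (auto simp: x_def simp del: of_nat_Suc)
      \<comment> \<open>Two-sided control of \<open>w\<close>: |w| \<le> N^4 + 1 because x > 1, and
        1/|w| \<le> 1 + 2 N^4 because |N^4 - x^4| \<ge> 1/2. Their sum is at most 5 N^4; the factor
        4 of \<open>inverse_sinh_squared_le\<close> then gives the constant 20.\<close>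
      define w where "w = (N ^ 4 - x ^ 4) / x ^ 4"
      have "w \<noteq> 0" using d x by (auto simp: w_def)
      have "\<bar>N ^ 4 - x ^ 4\<bar> \<le> N ^ 4 * x ^ 4 + 1 * x ^ 4"
        using mult_left_mono[of 1 "x ^ 4" "N ^ 4"] x N by linarith
      then have w1: "\<bar>w\<bar> \<le> N ^ 4 + 1"
        using x unfolding w_def abs_divide by (simp add: field_simps)
      have "x ^ 4 \<le> \<bar>N ^ 4 - x ^ 4\<bar> + N ^ 4" using N by linarith
      also have "\<dots> \<le> (1 + 2 * N ^ 4) * \<bar>N ^ 4 - x ^ 4\<bar>"
        using mult_left_mono[OF d, of "2 * N ^ 4"] N by (simp add: algebra_simps)
      finally have "x ^ 4 / \<bar>N ^ 4 - x ^ 4\<bar> \<le> 1 + 2 * N ^ 4"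
        using d by (subst pos_divide_le_eq) linarith+
      then have w2: "1 / \<bar>w\<bar> \<le> 1 + 2 * N ^ 4"
        using x unfolding w_def abs_divide by simp
      have "\<bar>ln \<bar>w\<bar>\<bar> \<le> 5 * N ^ 4"
        using abs_ln_abs_le[OF \<open>w \<noteq> 0\<close>] w1 w2 N by linarith
      then have "\<bar>ln \<bar>w\<bar>\<bar> * (1 / (sinh (pi * N))\<^sup>2) \<le> 5 * N ^ 4 * (4 * exp (- N))"
        unfolding N_def using inverse_sinh_squared_le[of "Suc k"] by (intro mult_mono) auto
      moreover have "ln \<bar>N ^ 4 - x ^ 4\<bar> - 4 * ln x = ln \<bar>w\<bar>"
        unfolding w_def N_def x_def by (rule quot) simp
      ultimately show "\<bar>(ln \<bar>real (Suc k) ^ 4 - (real n + 1 / 2) ^ 4\<bar> - 4 * ln (real n + 1 / 2)) / (sinh (pi * real (Suc k)))\<^sup>2\<bar>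
        \<le> 20 * (real (Suc k) ^ 4 * exp (- (1 * real (Suc k))))"
        unfolding N_def[symmetric] x_def[symmetric] by (simp add: mult_ac)
    qed
  qed auto
  then show ?thesis by simp
qed

text \<open>At half-integers cot(pi x) = 0 and |2 sin(pi x)| = 2. Each log term behaves like 4 ln x
  / sinh^2(pi k), so the log series with its factor -pi/2 contributes -2 pi s to the coefficient of
  ln x.\<close>

lemma digamma_expansion_half_integer_asymptotics:
  defines "s \<equiv> \<Sum>k. 1 / (sinh (pi * real (Suc k)))\<^sup>2"
  shows "(\<lambda>n. digamma_expansion (real n + 1 / 2) - (pi / 3 - 2 * pi * s) * ln (real n + 1 / 2)) \<longlonglongrightarrow> 0"
proof -
  define x where "x n = real n + 1 / 2" for n
  have x: "x n > 0" "x n \<notin> \<int>" for n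
    unfolding x_def by (rule add_nonneg_pos, auto intro: half_integer_not_Int)
  define h where "h n = (\<Sum>k. (ln \<bar>real (Suc k) ^ 4 - x n ^ 4\<bar> - 4 * ln (x n)) / (sinh (pi * real (Suc k)))\<^sup>2)" for n
  have ss: "summable (\<lambda>k. 1 / (sinh (pi * real (Suc k)))\<^sup>2)"
  proof (rule summable_comparison_test'[where N = 0])
    show "summable (\<lambda>k. 4 * (real (Suc k) ^ 0 * exp (- (1 * real (Suc k)))))"
      by (intro summable_power_times_exp) simp
    show "norm (1 / (sinh (pi * real (Suc k)))\<^sup>2) \<le> 4 * (real (Suc k) ^ 0 * exp (- (1 * real (Suc k))))" for k
      using inverse_sinh_squared_le[of "Suc k"] by (simp del: of_nat_Suc)
  qed
  have log: "(\<Sum>k. log_term (x n) (Suc k)) = h n + 4 * ln (x n) * s" for n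
  proof -
    have "(\<lambda>k. log_term (x n) (Suc k) - 4 * ln (x n) * (1 / (sinh (pi * real (Suc k)))\<^sup>2)) sums
        ((\<Sum>k. log_term (x n) (Suc k)) - 4 * ln (x n) * s)"
      unfolding s_def by (intro sums_diff sums_mult summable_sums summable_log_term x ss)
    moreover have "(\<lambda>k. log_term (x n) (Suc k) - 4 * ln (x n) * (1 / (sinh (pi * real (Suc k)))\<^sup>2)) =
        (\<lambda>k. (ln \<bar>real (Suc k) ^ 4 - x n ^ 4\<bar> - 4 * ln (x n)) / (sinh (pi * real (Suc k)))\<^sup>2)"
      by (simp add: log_term_def diff_divide_distrib del: of_nat_Suc)
    ultimately show ?thesis
      unfolding h_def by (simp add: sums_iff)
  qed
  have h: "h \<longlonglongrightarrow> 0"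
    unfolding h_def x_def by (rule log_quotient_sum_tendsto_0)
  have R: "(\<lambda>n. \<Sum>k. rational_term (x n) (Suc k)) \<longlonglongrightarrow> (\<Sum>k. 0)"
  proof (rule tendsto_suminf_dominated)
    show "summable (\<lambda>k. 2 / (1 / 2) * (real (Suc k) ^ 1 * exp (- (1 * real (Suc k)))))"
      by (intro summable_power_times_exp) simp
    show "(\<lambda>n. rational_term (x n) (Suc k)) \<longlonglongrightarrow> 0" for k
    proof -
      have "(\<lambda>n. 1 / (c - (real n + 1 / 2)\<^sup>2)) \<longlonglongrightarrow> 0" for c :: real
        by real_asymp
      then have "(\<lambda>n. 2 * real (Suc k) / (exp (2 * pi * real (Suc k)) - 1) * (1 / ((real (Suc k))\<^sup>2 - (x n)\<^sup>2))) \<longlonglongrightarrow> 0"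
        unfolding x_def by (intro tendsto_mult_right_zero)
      then show ?thesis
        by (simp add: rational_term_def del: of_nat_Suc)
    qed
    show "\<forall>\<^sub>F n in sequentially. \<forall>k. \<bar>rational_term (x n) (Suc k)\<bar> \<le> 2 / (1 / 2) * (real (Suc k) ^ 1 * exp (- (1 * real (Suc k))))"
      using x(1) half_integer_dist by (intro always_eventually allI abs_rational_term_le) (auto simp: x_def simp del: of_nat_Suc)
  qed auto
  have T: "(\<lambda>n. \<Sum>k. trig_term (x n) (Suc k)) \<longlonglongrightarrow> (\<Sum>k. 0)"
  proof (rule tendsto_suminf_dominated)
    show "summable (\<lambda>k. 4 * (real (Suc k) ^ 3 * exp (- (2 * pi * 1 * real (Suc k)))))"
      by (intro summable_power_times_exp) simp
    show "(\<lambda>n. trig_term (x n) (Suc k)) \<longlonglongrightarrow> 0" for k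
    proof (rule Lim_null_comparison[OF always_eventually])
      show "\<forall>n. norm (trig_term (x n) (Suc k)) \<le> 4 * (real (Suc k) ^ 3 * exp (- (2 * pi * x n * real (Suc k))))"
        unfolding real_norm_def using x(1) by (intro allI abs_trig_term_le) auto
      have "(\<lambda>n. exp (- (2 * pi * (real n + 1 / 2) * real (Suc k)))) \<longlonglongrightarrow> 0"
        by real_asymp
      then show "(\<lambda>n. 4 * (real (Suc k) ^ 3 * exp (- (2 * pi * x n * real (Suc k))))) \<longlonglongrightarrow> 0"
        unfolding x_def by (intro tendsto_mult_right_zero)
    qed
    show "\<forall>\<^sub>F n in sequentially. \<forall>k. \<bar>trig_term (x n) (Suc k)\<bar> \<le> 4 * (real (Suc k) ^ 3 * exp (- (2 * pi * 1 * real (Suc k))))"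
    proof (rule eventually_mono[OF eventually_ge_at_top[of "1::nat"]], intro allI)
      fix n k :: nat assume "1 \<le> n"
      then show "\<bar>trig_term (x n) (Suc k)\<bar> \<le> 4 * (real (Suc k) ^ 3 * exp (- (2 * pi * 1 * real (Suc k))))"
        by (intro abs_trig_term_le) (auto simp: x_def)
    qed
  qed auto
  have sin1: "\<bar>sin (pi * x n)\<bar> = 1" for n
    unfolding x_def using abs_sin_pi_add_nat[of n "1 / 2"] by simp
  have "cos (pi * x n) = 0" for n
    using sin1[of n] sin_cos_squared_add[of "pi * x n"] by (metis add_cancel_left_right power2_abs one_power2 power2_eq_iff zero_eq_power2)
  then have cot0: "cot (pi * x n) = 0" for n
    by (simp add: cot_def)
  have S: "(\<lambda>n. pi * ln 2 / (2 * (sinh (pi * x n))\<^sup>2)) \<longlonglongrightarrow> 0"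
    unfolding x_def by real_asymp
  have A: "(\<lambda>n. 1 / (2 * x n) - 1 / (4 * pi * (x n)\<^sup>2)) \<longlonglongrightarrow> 0"
    unfolding x_def by real_asymp
  have "(\<lambda>n. (1 / (2 * x n) - 1 / (4 * pi * (x n)\<^sup>2)) + pi * ln 2 / (2 * (sinh (pi * x n))\<^sup>2)
      + (\<Sum>k. rational_term (x n) (Suc k)) - pi / 2 * h n - 2 * pi * (\<Sum>k. trig_term (x n) (Suc k))) \<longlonglongrightarrow>
      0 + 0 + (\<Sum>k::nat. 0) - pi / 2 * 0 - 2 * pi * (\<Sum>k::nat. 0)"
    by (intro tendsto_add tendsto_diff tendsto_mult A S R h T tendsto_const)
  moreover have "(1 / (2 * x n) - 1 / (4 * pi * (x n)\<^sup>2)) + pi * ln 2 / (2 * (sinh (pi * x n))\<^sup>2)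
      + (\<Sum>k. rational_term (x n) (Suc k)) - pi / 2 * h n - 2 * pi * (\<Sum>k. trig_term (x n) (Suc k)) =
      digamma_expansion (x n) - (pi / 3 - 2 * pi * s) * ln (x n)" for n
  proof -
    have "\<bar>2 * sin (pi * x n)\<bar> = 2" using sin1[of n] by (simp add: abs_mult)
    then show ?thesis
      unfolding digamma_expansion_def log by (simp add: cot0 algebra_simps)
  qed
  ultimately show ?thesis
    by (simp add: x_def)
qed

section \<open>The constant of integration\<close>

lemma digamma_expansion_eq:
  assumes x: "x > 0" "x \<notin> \<int>"
  shows "Digamma (x + 1) = digamma_expansion x"
proof -
  define F where "F x = digamma_expansion x - Digamma (x + 1)" for x
  have F': "(F has_real_derivative 0) (at y)" if "y > 0" "y \<notin> \<int>" for y
  proof -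
    have "y + 1 \<notin> \<int>\<^sub>\<le>\<^sub>0" using that by (auto elim!: nonpos_Ints_cases)
    then have "((\<lambda>y. Digamma (y + 1)) has_real_derivative Polygamma 1 (y + 1)) (at y)"
      by (auto intro!: derivative_eq_intros)
    from DERIV_diff[OF DERIV_digamma_expansion[OF that(2,1)] this]
    show ?thesis unfolding F_def by simp
  qed
  have ni: "y \<notin> \<int>" if "real n < y" "y < real n + 1" for y n
  proof
    assume "y \<in> \<int>"
    then obtain j where "y = of_int j" by (auto elim: Ints_cases)
    then have "of_int (int n) < (of_int j :: real)" "(of_int j :: real) < of_int (int n + 1)"
      using that by simp_all
    then show False by (simp only: of_int_less_iff)
  qed
  define c where "c n = F (real n + 1 / 2)" for n
  have const: "F y = c n" if "real n < y" "y < real n + 1" for y n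
    unfolding c_def
  proof (rule DERIV_isconst3[where f = F and a = "real n" and b = "real n + 1"])
    show "(F has_real_derivative 0) (at z)" if "z \<in> {real n<..<real n + 1}" for z
      using that ni[of n z] by (intro F') auto
  qed (use that in auto)
  \<comment> \<open>\<open>F\<close> has a two-sided limit at the integer between two neighbouring
    intervals, so the one-sided limits, which are the two constants, coincide.\<close>
  have step: "c (Suc n) = c n" for n
  proof -
    define a where "a = real (Suc n)"
    obtain l where "(digamma_expansion \<longlongrightarrow> l) (at a)"
      using digamma_expansion_limit_at_nat[of "Suc n"] by (auto simp: a_def)
    moreover have "((\<lambda>y. Digamma (y + 1)) \<longlongrightarrow> Digamma (a + 1)) (at a)"
      by (intro tendsto_intros) (auto simp: a_def elim!: nonpos_Ints_cases)
    ultimately have lim: "(F \<longlongrightarrow> l - Digamma (a + 1)) (at a)"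
      unfolding F_def by (rule tendsto_diff)
    have right: "(F \<longlongrightarrow> c (Suc n)) (at_right a)"
    proof (rule tendsto_eventually)
      have "\<forall>\<^sub>F y in at_right a. y < a + 1"
        by (rule order_tendstoD(2)[OF tendsto_ident_at]) simp
      moreover have "\<forall>\<^sub>F y in at_right a. y > a"
        by (simp add: eventually_at_filter)
      ultimately show "\<forall>\<^sub>F y in at_right a. F y = c (Suc n)"
        by eventually_elim (rule const, auto simp: a_def)
    qed
    have left: "(F \<longlongrightarrow> c n) (at_left a)"
    proof (rule tendsto_eventually)
      have "\<forall>\<^sub>F y in at_left a. y > a - 1"
        by (rule order_tendstoD(1)[OF tendsto_ident_at]) simp
      moreover have "\<forall>\<^sub>F y in at_left a. y < a"
        by (simp add: eventually_at_filter)
      ultimately show "\<forall>\<^sub>F y in at_left a. F y = c n"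
        by eventually_elim (rule const, auto simp: a_def)
    qed
    have "c (Suc n) = l - Digamma (a + 1)"
      using right lim by (intro tendsto_unique[OF trivial_limit_at_right_real]) (auto simp: filterlim_at_split)
    moreover have "c n = l - Digamma (a + 1)"
      using left lim by (intro tendsto_unique[OF trivial_limit_at_left_real]) (auto simp: filterlim_at_split)
    ultimately show ?thesis by simp
  qed
  have "c n = c 0" for n
    by (induction n) (simp_all add: step)
  then obtain d where c0: "\<And>n. c n = d" by blast
  \<comment> \<open>The final -1 accounts for \<open>Digamma (x + 1)\<close> growing like ln
    x.\<close>
  define k where "k = pi / 3 - 2 * pi * (\<Sum>k. 1 / (sinh (pi * real (Suc k)))\<^sup>2) - 1"
  from tendsto_diff[OF digamma_expansion_half_integer_asymptotics Digamma_half_minus_ln_tendsto]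
  have "(\<lambda>n. c n - k * ln (real n + 1 / 2)) \<longlonglongrightarrow> 0"
    by (simp add: c_def F_def k_def algebra_simps)
  then have lim: "(\<lambda>n. d - k * ln (real n + 1 / 2)) \<longlonglongrightarrow> 0"
    by (simp only: c0)
  \<comment> \<open>The value of the sum of \<open>1 / sinh\<^sup>2 (\<pi>k)\<close> is not needed: it is forced by the convergence.\<close>
  have "k = 0"
  proof (rule ccontr)
    assume "k \<noteq> 0"
    have "(\<lambda>n. (d - (d - k * ln (real n + 1 / 2))) / k) \<longlonglongrightarrow> (d - 0) / k"
      using \<open>k \<noteq> 0\<close> by (intro tendsto_intros lim)
    then have "(\<lambda>n. ln (real n + 1 / 2)) \<longlonglongrightarrow> d / k"
      using \<open>k \<noteq> 0\<close> by simp
    moreover have "filterlim (\<lambda>n. ln (real n + 1 / 2)) at_infinity sequentially"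
      by real_asymp
    ultimately show False
      using not_tendsto_and_filterlim_at_infinity[OF sequentially_bot] by blast
  qed
  then have "d = 0"
    using lim by (simp add: LIMSEQ_const_iff)
  moreover have "F x = c (nat \<lfloor>x\<rfloor>)"
  proof (rule const)
    have "of_int \<lfloor>x\<rfloor> \<noteq> x" using x by (metis Ints_of_int)
    then show "real (nat \<lfloor>x\<rfloor>) < x" "x < real (nat \<lfloor>x\<rfloor>) + 1"
      using x(1) by linarith+
  qed
  ultimately show ?thesis
    using c0[of "nat \<lfloor>x\<rfloor>"] by (simp add: F_def)
qed

theorem mainTheorem1:
  fixes x :: real
  assumes "x > 0"
  shows "(x \<notin> \<int> \<longrightarrow>
           (\<forall>k::nat. k \<ge> 1 \<longrightarrow>
              summable (\<lambda>n. sin_term x k (Suc n)) \<and> summable (\<lambda>n. cos_term x k (Suc n))) \<and>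
           summable (\<lambda>k. rational_term x (Suc k)) \<and>
           summable (\<lambda>k. log_term x (Suc k)) \<and>
           summable (\<lambda>k. trig_term x (Suc k)) \<and>
           Digamma (x + 1) = digamma_expansion x) \<and>
         (x \<in> \<int> \<longrightarrow> (digamma_expansion \<longlongrightarrow> Digamma (x + 1)) (at x within - \<int>))"
proof (intro conjI impI allI)
  assume x: "x \<notin> \<int>"
  show "summable (\<lambda>n. sin_term x k (Suc n))" "summable (\<lambda>n. cos_term x k (Suc n))" for k
    by (rule summable_sin_term summable_cos_term)+
  show "summable (\<lambda>k. rational_term x (Suc k))" "summable (\<lambda>k. log_term x (Suc k))" "summable (\<lambda>k. trig_term x (Suc k))"
    "Digamma (x + 1) = digamma_expansion x"
    using x assms by (simp_all add: summable_rational_term summable_log_term summable_trig_term digamma_expansion_eq)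
next
  \<comment> \<open>At an integer the identity is available at the surrounding positive
    non-integers, and continuity of \<open>Digamma\<close> at \<open>x + 1\<close> identifies the
    limit.\<close>
  have "x + 1 \<notin> \<int>\<^sub>\<le>\<^sub>0" using assms by (auto elim!: nonpos_Ints_cases)
  then have "((\<lambda>y. Digamma (y + 1)) \<longlongrightarrow> Digamma (x + 1)) (at x within - \<int>)"
    by (intro tendsto_intros)
  moreover have "\<forall>\<^sub>F y in at x within - \<int>. y > 0"
    using assms by (intro order_tendstoD[OF tendsto_ident_at]) auto
  then have "\<forall>\<^sub>F y in at x within - \<int>. Digamma (y + 1) = digamma_expansion y"
    unfolding eventually_at_filter by eventually_elim (auto intro: digamma_expansion_eq)
  ultimately show "(digamma_expansion \<longlongrightarrow> Digamma (x + 1)) (at x within - \<int>)"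
    by (rule Lim_transform_eventually)
qed

end
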